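(* Let $G$ be an undirected graph on $n$ vertices and let $F_1,\dots,F_n$ be sets of edges of $G$ with $1\le |F_i|\le 2$ for all $i$. Let $p$ be the number of indices $i$ with $|F_i|=1$. Then $G$ contains a rainbow cycle of length at most $\left\lceil \frac{n+p}{2}\right\rceil$.
   Context: A set $R$ of edges is rainbow if $R=\{e_{i_1},\dots,e_{i_k}\}$ for distinct indices $i_1<\dots<i_k$ with $e_{i_j}\in F_{i_j}$, i.e. it is the image of a partial choice function picking at most one edge from each $F_i$. A rainbow cycle is a cycle whose edges are chosen in this way from distinct sets $F_i$; in particular, an edge belonging to two different sets $F_i,F_j$ yields a rainbow cycle of length $2$. *)

theory Defs
  imports Complex_Main "HOL-Library.Ramsey"
begin

definition simple_graph :: "'v set \<Rightarrow> 'v set set \<Rightarrow> bool" where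
  "simple_graph V E \<longleftrightarrow> finite V \<and> E \<subseteq> nsets V 2"

(* The edges met when going once around the cyclic sequence vs, with repetition:
   for vs = [u, v] this is [{u, v}, {v, u}], i.e. the same edge listed twice. *)
definition cycle_edges :: "'v list \<Rightarrow> 'v set list" where
  "cycle_edges vs = map (\<lambda>j. {vs ! j, vs ! (Suc j mod length vs)}) [0..<length vs]"

(* Length 2 is admitted: it is one edge traversed back and forth. Such a degenerate
   cycle is rainbow exactly when its edge lies in two sets with different indices. *)
definition cycle :: "'v set set \<Rightarrow> 'v list \<Rightarrow> bool" where
  "cycle E vs \<longleftrightarrow> 2 \<le> length vs \<and> distinct vs \<and> set (cycle_edges vs) \<subseteq> E"

definition rainbow :: "'i set \<Rightarrow> ('i \<Rightarrow> 'e set) \<Rightarrow> 'e list \<Rightarrow> bool" where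
  "rainbow I F es \<longleftrightarrow>
     (\<exists>c. inj_on c {..<length es} \<and> (\<forall>j<length es. c j \<in> I \<and> es ! j \<in> F (c j)))"

definition rainbow_cycle :: "'v set set \<Rightarrow> 'i set \<Rightarrow> ('i \<Rightarrow> 'v set set) \<Rightarrow> 'v list \<Rightarrow> bool" where
  "rainbow_cycle E I F vs \<longleftrightarrow> cycle E vs \<and> rainbow I F (cycle_edges vs)"

end

theory Submission
  imports Defs "HOL-Library.Disjoint_Sets"
begin

text \<open>Write \<open>E\<close> for the sum of the \<open>|F i|\<close>. By induction on \<open>n\<close>, if \<open>E < 2n\<close> then some rainbow cycle
  has length \<open>L\<close> with \<open>2L + E \<le> 3n\<close>. In a minimal counterexample the sets \<open>F i\<close> are disjoint, and
  deleting a vertex set \<open>Z\<close> that touches at most \<open>3|Z|\<close> edges must destroy more than \<open>|Z|\<close> colours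
  (surplus colours left on the rest can be dropped, or merged in pairs of singletons). Applied to
  single vertices this gives \<open>deg v + s v \<ge> 4\<close>, where \<open>s v\<close> counts the singletons at \<open>v\<close>. These
  numbers add up to \<open>4n\<close>, so equality holds everywhere, and at an end of a singleton edge there are
  exactly two colours, both with all their edges at that vertex. Contracting a singleton edge
  \<open>{x, y}\<close> contradicts minimality unless it is the only singleton and \<open>n = 2h\<close>. In that case a
  deletion argument grows a set around \<open>y\<close>, gaining two vertices per unit of radius, which must
  avoid \<open>x\<close>, the two further neighbours \<open>p\<close>, \<open>q\<close> of \<open>x\<close>, and the neighbours of \<open>p\<close> and \<open>q\<close>. So few
  vertices remain for the latter that a rainbow triangle appears.\<close>

section \<open>Rainbow paths and circuits\<close>

fun path_edges :: "'v list \<Rightarrow> 'v set list" where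
  "path_edges (u # v # vs) = {u, v} # path_edges (v # vs)"
| "path_edges _ = []"

lemma length_path_edges [simp]: "length (path_edges vs) = length vs - 1"
  by (induction vs rule: path_edges.induct) auto

lemma nth_path_edges: "Suc j < length vs \<Longrightarrow> path_edges vs ! j = {vs ! j, vs ! Suc j}"
proof (induction vs arbitrary: j rule: path_edges.induct)
  case (1 u v vs)
  then show ?case by (cases j) auto
qed auto

lemma path_edges_snoc: "vs \<noteq> [] \<Longrightarrow> path_edges (vs @ [v]) = path_edges vs @ [{last vs, v}]"
  by (induction vs rule: path_edges.induct) auto

lemma path_edges_Cons: "vs \<noteq> [] \<Longrightarrow> path_edges (v # vs) = {v, hd vs} # path_edges vs"
  by (cases vs) auto

lemma path_edges_rev: "path_edges (rev vs) = rev (path_edges vs)"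
proof (induction vs rule: path_edges.induct)
  case (1 u v vs)
  then show ?case
    using path_edges_snoc[of "rev vs @ [v]" u] by (simp add: insert_commute)
qed auto

lemma set_path_edges_subset: "e \<in> set (path_edges vs) \<Longrightarrow> e \<subseteq> set vs"
  by (induction vs rule: path_edges.induct) auto

text \<open>Trades indices modulo the length for a recursive path and one closing edge. For two
  vertices the closing edge repeats the path edge.\<close>

lemma cycle_edges_eq: "vs \<noteq> [] \<Longrightarrow> cycle_edges vs = path_edges vs @ [{last vs, hd vs}]"
proof (rule nth_equalityI)
  assume ne: "vs \<noteq> []"
  then show "length (cycle_edges vs) = length (path_edges vs @ [{last vs, hd vs}])"
    by (simp add: cycle_edges_def)
  fix j assume j: "j < length (cycle_edges vs)"
  show "cycle_edges vs ! j = (path_edges vs @ [{last vs, hd vs}]) ! j"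
  proof (cases "Suc j < length vs")
    case True
    then have "j < length vs - Suc 0" by simp
    with True show ?thesis by (simp add: cycle_edges_def nth_append nth_path_edges)
  next
    case False
    with j have "j = length vs - 1" "Suc j = length vs" by (auto simp: cycle_edges_def)
    with ne show ?thesis
      by (simp add: cycle_edges_def nth_append last_conv_nth hd_conv_nth)
  qed
qed

text \<open>A list of colours aligned with the edges is easier to append, reverse and rotate than a
  choice function on positions.\<close>

lemma rainbow_iff:
  "rainbow I F es \<longleftrightarrow> (\<exists>cs. distinct cs \<and> set cs \<subseteq> I \<and> list_all2 (\<lambda>e c. e \<in> F c) es cs)"
proof
  assume "rainbow I F es"
  then obtain c where c: "inj_on c {..<length es}" "\<And>j. j < length es \<Longrightarrow> c j \<in> I \<and> es ! j \<in> F (c j)"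
    unfolding rainbow_def by auto
  show "\<exists>cs. distinct cs \<and> set cs \<subseteq> I \<and> list_all2 (\<lambda>e c. e \<in> F c) es cs"
    by (rule exI[of _ "map c [0..<length es]"])
      (use c in \<open>auto simp: distinct_map list_all2_conv_all_nth lessThan_atLeast0\<close>)
next
  assume "\<exists>cs. distinct cs \<and> set cs \<subseteq> I \<and> list_all2 (\<lambda>e c. e \<in> F c) es cs"
  then obtain cs where cs: "distinct cs" "set cs \<subseteq> I" "list_all2 (\<lambda>e c. e \<in> F c) es cs" by auto
  then show "rainbow I F es"
    unfolding rainbow_def list_all2_conv_all_nth
    by (intro exI[of _ "\<lambda>j. cs ! j"]) (auto simp: inj_on_def nth_eq_iff_index_eq)
qed

lemma rainbow_mono:
  assumes "rainbow J F es" "J \<subseteq> I" "\<And>j. j \<in> J \<Longrightarrow> F j \<inter> set es \<subseteq> G j"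
  shows "rainbow I G es"
proof -
  obtain c where c: "inj_on c {..<length es}" "\<And>j. j < length es \<Longrightarrow> c j \<in> J \<and> es ! j \<in> F (c j)"
    using assms(1) unfolding rainbow_def by auto
  then have "\<forall>j<length es. c j \<in> I \<and> es ! j \<in> G (c j)"
    using assms(2,3) by (metis IntI nth_mem subsetD)
  with c(1) show ?thesis unfolding rainbow_def by blast
qed

lemma rainbow_Nil [simp]: "rainbow I F []"
  by (simp add: rainbow_def)

lemma rainbow_Cons:
  assumes "rainbow J F es" "c \<notin> J" "e \<in> F c"
  shows "rainbow (insert c J) F (e # es)"
proof -
  from assms(1) obtain cs where "distinct cs" "set cs \<subseteq> J" "list_all2 (\<lambda>e c. e \<in> F c) es cs"
    unfolding rainbow_iff by auto
  with assms(2,3) show ?thesis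
    unfolding rainbow_iff by (intro exI[of _ "c # cs"]) auto
qed

lemma rainbow_rev [simp]: "rainbow I F (rev es) \<longleftrightarrow> rainbow I F es"
proof -
  have "rainbow I F (rev es)" if "rainbow I F es" for es
  proof -
    from that obtain cs where "distinct cs" "set cs \<subseteq> I" "list_all2 (\<lambda>e c. e \<in> F c) es cs"
      unfolding rainbow_iff by auto
    then show ?thesis
      unfolding rainbow_iff by (intro exI[of _ "rev cs"]) auto
  qed
  from this[of es] this[of "rev es"] show ?thesis by auto
qed

lemma rainbow_rotate1: "rainbow I F (es @ [e]) \<longleftrightarrow> rainbow I F (e # es)"
proof
  assume "rainbow I F (es @ [e])"
  then obtain cs where cs: "distinct cs" "set cs \<subseteq> I" "list_all2 (\<lambda>e c. e \<in> F c) (es @ [e]) cs"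
    unfolding rainbow_iff by auto
  from cs(3) obtain ds c where "cs = ds @ [c]" "list_all2 (\<lambda>e c. e \<in> F c) es ds" "e \<in> F c"
    by (auto simp: list_all2_append1 list_all2_Cons1)
  with cs show "rainbow I F (e # es)"
    unfolding rainbow_iff by (intro exI[of _ "c # ds"]) auto
next
  assume "rainbow I F (e # es)"
  then obtain c cs where "distinct (c # cs)" "set (c # cs) \<subseteq> I" "e \<in> F c" "list_all2 (\<lambda>e c. e \<in> F c) es cs"
    unfolding rainbow_iff by (auto simp: list_all2_Cons1)
  then show "rainbow I F (es @ [e])"
    unfolding rainbow_iff by (intro exI[of _ "cs @ [c]"]) (auto simp: list_all2_appendI)
qed

text \<open>Membership of the edges in a graph is left out: it follows from the colouring.\<close>

definition rainbow_circuit :: "'i set \<Rightarrow> ('i \<Rightarrow> 'v set set) \<Rightarrow> 'v list \<Rightarrow> bool" where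
  "rainbow_circuit I F vs \<longleftrightarrow>
     2 \<le> length vs \<and> distinct vs \<and> rainbow I F (path_edges vs @ [{last vs, hd vs}])"

lemma rainbow_circuit_mono:
  assumes "rainbow_circuit J F vs" "J \<subseteq> I" "\<And>j. j \<in> J \<Longrightarrow> F j \<subseteq> G j"
  shows "rainbow_circuit I G vs"
  using assms rainbow_mono[of J F _ I G] unfolding rainbow_circuit_def by blast

lemma rainbow_circuit_rotate1:
  "rainbow_circuit I F (xs @ [x]) \<longleftrightarrow> rainbow_circuit I F (x # xs)"
proof (cases "xs = []")
  case False
  then have "path_edges (xs @ [x]) @ [{last (xs @ [x]), hd (xs @ [x])}] =
      (path_edges xs @ [{last xs, x}]) @ [{x, hd xs}]"
    "path_edges (x # xs) @ [{last (x # xs), hd (x # xs)}] = {x, hd xs} # (path_edges xs @ [{last xs, x}])"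
    by (auto simp: path_edges_snoc path_edges_Cons)
  then show ?thesis
    unfolding rainbow_circuit_def by (simp only: rainbow_rotate1) auto
qed simp

lemma rainbow_circuit_append_commute:
  "rainbow_circuit I F (xs @ ys) \<longleftrightarrow> rainbow_circuit I F (ys @ xs)"
proof (induction xs arbitrary: ys)
  case (Cons x xs)
  from Cons[of "ys @ [x]"] rainbow_circuit_rotate1[of I F "xs @ ys" x] show ?case by simp
qed simp

lemma rainbow_circuit_close:
  assumes "rainbow J F (path_edges ps)" "distinct ps" "2 \<le> length ps"
    and "J \<subseteq> I" "c \<in> I" "c \<notin> J" "{last ps, hd ps} \<in> F c"
  shows "rainbow_circuit I F ps"
proof -
  have "rainbow (insert c J) F ({last ps, hd ps} # path_edges ps)"
    using assms by (intro rainbow_Cons)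
  then have "rainbow I F ({last ps, hd ps} # path_edges ps)"
    by (rule rainbow_mono) (use assms in auto)
  then show ?thesis
    using assms unfolding rainbow_circuit_def by (simp only: rainbow_rotate1)
qed

text \<open>Separates the two edges at \<open>v\<close> from the path on the rest, so that
  \<open>v\<close> can be exchanged for another vertex or for two. If \<open>ws\<close> is a single
  vertex, the path is empty and one edge is used in two colours.\<close>

lemma rainbow_circuit_Cons:
  assumes "ws \<noteq> []"
  shows "rainbow_circuit I F (v # ws) \<longleftrightarrow> v \<notin> set ws \<and> distinct ws \<and>
    (\<exists>c cs d. distinct (c # cs @ [d]) \<and> set (c # cs @ [d]) \<subseteq> I \<and> {v, hd ws} \<in> F c \<and>
      list_all2 (\<lambda>e c. e \<in> F c) (path_edges ws) cs \<and> {last ws, v} \<in> F d)"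
    (is "?L \<longleftrightarrow> ?R")
proof -
  have len: "2 \<le> length (v # ws)" using assms by (cases ws) auto
  have e: "path_edges (v # ws) @ [{last (v # ws), hd (v # ws)}] =
      {v, hd ws} # path_edges ws @ [{last ws, v}]"
    using assms by (simp add: path_edges_Cons)
  have "rainbow I F ({v, hd ws} # path_edges ws @ [{last ws, v}]) \<longleftrightarrow>
    (\<exists>c cs d. distinct (c # cs @ [d]) \<and> set (c # cs @ [d]) \<subseteq> I \<and> {v, hd ws} \<in> F c \<and>
      list_all2 (\<lambda>e c. e \<in> F c) (path_edges ws) cs \<and> {last ws, v} \<in> F d)"
  proof
    assume "rainbow I F ({v, hd ws} # path_edges ws @ [{last ws, v}])"
    then obtain ds where ds: "distinct ds" "set ds \<subseteq> I"
      "list_all2 (\<lambda>e c. e \<in> F c) ({v, hd ws} # path_edges ws @ [{last ws, v}]) ds"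
      unfolding rainbow_iff by auto
    from ds(3) obtain c cs d where "ds = c # cs @ [d]" "{v, hd ws} \<in> F c"
      "list_all2 (\<lambda>e c. e \<in> F c) (path_edges ws) cs" "{last ws, v} \<in> F d"
      by (auto simp: list_all2_append1 list_all2_Cons1)
    with ds show "\<exists>c cs d. distinct (c # cs @ [d]) \<and> set (c # cs @ [d]) \<subseteq> I \<and> {v, hd ws} \<in> F c \<and>
      list_all2 (\<lambda>e c. e \<in> F c) (path_edges ws) cs \<and> {last ws, v} \<in> F d" by blast
  next
    assume "\<exists>c cs d. distinct (c # cs @ [d]) \<and> set (c # cs @ [d]) \<subseteq> I \<and> {v, hd ws} \<in> F c \<and>
      list_all2 (\<lambda>e c. e \<in> F c) (path_edges ws) cs \<and> {last ws, v} \<in> F d"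
    then obtain c cs d where "distinct (c # cs @ [d])" "set (c # cs @ [d]) \<subseteq> I" "{v, hd ws} \<in> F c"
      "list_all2 (\<lambda>e c. e \<in> F c) (path_edges ws) cs" "{last ws, v} \<in> F d" by blast
    then show "rainbow I F ({v, hd ws} # path_edges ws @ [{last ws, v}])"
      unfolding rainbow_iff by (intro exI[of _ "c # cs @ [d]"]) (auto intro: list_all2_appendI)
  qed
  then show ?thesis
    unfolding rainbow_circuit_def e using len by auto
qed

lemma rainbow_circuitE:
  assumes "rainbow_circuit I F vs"
  obtains cs where "distinct cs" "set cs \<subseteq> I"
    "list_all2 (\<lambda>e c. e \<in> F c) (path_edges vs @ [{last vs, hd vs}]) cs"
  using assms unfolding rainbow_circuit_def rainbow_iff by auto

lemma vertex_in_path_edges: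
  "2 \<le> length vs \<Longrightarrow> v \<in> set vs \<Longrightarrow> \<exists>e\<in>set (path_edges vs). v \<in> e"
proof (induction vs rule: path_edges.induct)
  case (1 u w vs)
  then show ?case by (cases vs) auto
qed auto

lemma rainbow_edge: "rainbow I F es \<Longrightarrow> e \<in> set es \<Longrightarrow> \<exists>i\<in>I. e \<in> F i"
  unfolding rainbow_def by (metis in_set_conv_nth)

lemma rainbow_circuit_subset:
  assumes "rainbow_circuit I F vs" "\<And>i. i \<in> I \<Longrightarrow> \<Union>(F i) \<subseteq> V"
  shows "set vs \<subseteq> V"
proof
  fix v assume "v \<in> set vs"
  with assms(1) obtain e where "e \<in> set (path_edges vs)" "v \<in> e"
    unfolding rainbow_circuit_def using vertex_in_path_edges by metis
  with assms(1) obtain i where "i \<in> I" "e \<in> F i"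
    unfolding rainbow_circuit_def using rainbow_edge[of I F _ e] by fastforce
  with assms(2) \<open>v \<in> e\<close> show "v \<in> V" by blast
qed

text \<open>A rainbow list uses the merged colour at most once, and that use can be handed back to
  whichever of \<open>i\<close> and \<open>j\<close> contains the edge.\<close>

lemma rainbow_merge:
  assumes "rainbow (I - {j}) (F(i := F i \<union> F j)) es" "j \<in> I" "i \<noteq> j"
  shows "rainbow I F es"
proof -
  from assms(1) obtain c where c: "inj_on c {..<length es}"
    "\<And>k. k < length es \<Longrightarrow> c k \<in> I - {j} \<and> es ! k \<in> (F(i := F i \<union> F j)) (c k)"
    unfolding rainbow_def by auto
  define d where "d k = (if c k = i \<and> es ! k \<notin> F i then j else c k)" for k
  have "inj_on d {..<length es}"
  proof (rule inj_onI)
    fix k l assume "k \<in> {..<length es}" "l \<in> {..<length es}" "d k = d l"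
    then have "c k = c l"
      unfolding d_def using c(2)[of k] c(2)[of l] by (auto split: if_splits)
    then show "k = l" using c(1) \<open>k \<in> _\<close> \<open>l \<in> _\<close> by (auto dest: inj_onD)
  qed
  moreover have "d k \<in> I \<and> es ! k \<in> F (d k)" if "k < length es" for k
    unfolding d_def using c(2)[OF that] assms(2) by (auto split: if_splits)
  ultimately show ?thesis unfolding rainbow_def by blast
qed

lemma rainbow_circuit_merge:
  assumes "rainbow_circuit (I - {j}) (F(i := F i \<union> F j)) vs" "j \<in> I" "i \<noteq> j"
  shows "rainbow_circuit I F vs"
  using assms rainbow_merge unfolding rainbow_circuit_def by metis

lemma circuit_edges_rotate:
  assumes "vs \<noteq> []"
  shows "path_edges (rotate k vs) @ [{last (rotate k vs), hd (rotate k vs)}] =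
    rotate k (path_edges vs @ [{last vs, hd vs}])"
proof (induction k)
  case (Suc k)
  obtain x xs where x: "rotate k vs = x # xs" using assms by (cases "rotate k vs") auto
  have "path_edges (xs @ [x]) @ [{x, hd (xs @ [x])}] =
      rotate1 (path_edges (x # xs) @ [{last (x # xs), x}])"
    by (cases "xs = []") (simp_all add: path_edges_snoc path_edges_Cons)
  with x Suc show ?case by simp
qed simp

lemma list_all2_rotate: "list_all2 P xs ys \<Longrightarrow> list_all2 P (rotate k xs) (rotate k ys)"
proof (induction k)
  case (Suc k)
  have "list_all2 P (rotate1 xs) (rotate1 ys)" if "list_all2 P xs ys" for xs ys
    using that by cases (auto intro: list_all2_appendI)
  with Suc show ?case by simp
qed simp

text \<open>If colour \<open>c\<close> occurs, rotating the circuit makes its edge the closing one;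
  what precedes is a rainbow path in the other colours.\<close>

lemma rainbow_circuit_open:
  assumes "rainbow_circuit (insert c J) F vs"
  obtains "rainbow_circuit J F vs"
  | ps where "length ps = length vs" "distinct ps" "set ps = set vs"
      "{last ps, hd ps} \<in> F c" "rainbow J F (path_edges ps)"
proof -
  from assms obtain cs where cs: "distinct cs" "set cs \<subseteq> insert c J"
    "list_all2 (\<lambda>e c. e \<in> F c) (path_edges vs @ [{last vs, hd vs}]) cs"
    by (rule rainbow_circuitE)
  have vs: "2 \<le> length vs" "distinct vs" using assms unfolding rainbow_circuit_def by auto
  have len: "length cs = length vs"
    using list_all2_lengthD[OF cs(3)] vs by auto
  show thesis
  proof (cases "c \<in> set cs")
    case False
    then have "rainbow_circuit J F vs"
      using cs vs unfolding rainbow_circuit_def rainbow_iff by auto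
    with that(1) show thesis .
  next
    case True
    then obtain k where k: "k < length cs" "cs ! k = c" by (auto simp: in_set_conv_nth)
    \<comment> \<open>\<open>Suc k\<close> rotations, not \<open>k\<close>, move position
      \<open>k\<close> to the very end.\<close>
    define ps where "ps = rotate (Suc k) vs"
    have "list_all2 (\<lambda>e c. e \<in> F c) (path_edges ps @ [{last ps, hd ps}]) (rotate (Suc k) cs)"
      using list_all2_rotate[OF cs(3), of "Suc k"] vs circuit_edges_rotate[of vs "Suc k"]
      unfolding ps_def by (metis list.size(3) not_numeral_le_zero)
    moreover have rot: "rotate (Suc k) cs = drop (Suc k) cs @ take k cs @ [c]"
      using k rotate_append[of "take (Suc k) cs" "drop (Suc k) cs"] append_take_drop_id[of "Suc k" cs]
      by (simp add: take_Suc_conv_app_nth del: rotate_Suc append_take_drop_id)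
    ultimately have all: "list_all2 (\<lambda>e c. e \<in> F c) (path_edges ps @ [{last ps, hd ps}])
        ((drop (Suc k) cs @ take k cs) @ [c])"
      by simp
    have "length (path_edges ps) = length (drop (Suc k) cs @ take k cs)"
      using list_all2_lengthD[OF all] by simp
    with all have e: "list_all2 (\<lambda>e c. e \<in> F c) (path_edges ps) (drop (Suc k) cs @ take k cs)"
      "{last ps, hd ps} \<in> F c"
      by (simp_all only: list_all2_append list_all2_Cons)
    have "distinct (rotate (Suc k) cs)" "set (rotate (Suc k) cs) = set cs"
      using cs by (simp_all del: rotate_Suc)
    then have "distinct (drop (Suc k) cs @ take k cs @ [c])"
      "set (drop (Suc k) cs @ take k cs @ [c]) = set cs"
      unfolding rot .
    then have "rainbow J F (path_edges ps)"
      using e(1) cs unfolding rainbow_iff by (intro exI[of _ "drop (Suc k) cs @ take k cs"]) auto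
    with e(2) show thesis using vs by (intro that(2)[of ps]) (auto simp: ps_def)
  qed
qed

section \<open>Systems of colours\<close>

definition colouring :: "'v set \<Rightarrow> 'i set \<Rightarrow> ('i \<Rightarrow> 'v set set) \<Rightarrow> bool" where
  "colouring V I F \<longleftrightarrow> finite V \<and> finite I \<and>
     (\<forall>i\<in>I. F i \<subseteq> nsets V 2 \<and> 1 \<le> card (F i) \<and> card (F i) \<le> 2)"

abbreviation total :: "'i set \<Rightarrow> ('i \<Rightarrow> 'e set) \<Rightarrow> nat" where
  "total I F \<equiv> (\<Sum>i\<in>I. card (F i))"

lemma colouringD:
  assumes "colouring V I F"
  shows "finite V" "finite I" "i \<in> I \<Longrightarrow> F i \<subseteq> nsets V 2" "i \<in> I \<Longrightarrow> 1 \<le> card (F i)"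
    "i \<in> I \<Longrightarrow> card (F i) \<le> 2" "i \<in> I \<Longrightarrow> finite (F i)" "i \<in> I \<Longrightarrow> F i \<noteq> {}"
    "i \<in> I \<Longrightarrow> f \<in> F i \<Longrightarrow> f \<subseteq> V" "i \<in> I \<Longrightarrow> f \<in> F i \<Longrightarrow> card f = 2"
  using assms unfolding colouring_def nsets_def
  by (auto intro: card_ge_0_finite simp: Suc_le_eq)

lemma total_le: "colouring V I F \<Longrightarrow> total I F \<le> 2 * card I"
  using sum_bounded_above[of I "\<lambda>i. card (F i)" 2] colouringD(5)[of V I F]
  by (simp add: mult.commute)

lemma total_ge: "colouring V I F \<Longrightarrow> card I \<le> total I F"
  using sum_bounded_below[of I 1 "\<lambda>i. card (F i)"] colouringD(4)[of V I F] by simp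

lemma colouring_circuit_subset:
  assumes "colouring V I F" "rainbow_circuit I F vs"
  shows "set vs \<subseteq> V"
  by (rule rainbow_circuit_subset[OF assms(2)]) (use colouringD(8)[OF assms(1)] in blast)

text \<open>With \<open>p\<close> singletons the number of coloured edges, counted by colours, is \<open>2n - p\<close>, so the
  bound below reads \<open>2L \<le> n + p\<close>. Written this way it needs no case distinction and survives
  the removal of vertices. The case \<open>p = 0\<close> is excluded and recovered by dropping one edge.\<close>

definition short_circuits :: "'i itself \<Rightarrow> 'v set \<Rightarrow> bool" where
  "short_circuits T V \<longleftrightarrow> (\<forall>I (F :: 'i \<Rightarrow> 'v set set).
     colouring V I F \<longrightarrow> card I = card V \<longrightarrow> total I F < 2 * card V \<longrightarrow>
     (\<exists>vs. rainbow_circuit I F vs \<and> 2 * length vs + total I F \<le> 3 * card V))"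

text \<open>The bound only weakens as \<open>m\<close> drops below the total. The excluded total
  \<open>2 * card V\<close> is lowered by one by removing an edge from a double colour, and
  \<open>m < 2 * card V\<close> still lies below it.\<close>

lemma short_circuitsD:
  fixes F :: "'i \<Rightarrow> 'v set set"
  assumes "short_circuits TYPE('i) V" "colouring V I F" "card I = card V"
    and "m \<le> total I F" "m < 2 * card V"
  shows "\<exists>vs. rainbow_circuit I F vs \<and> 2 * length vs + m \<le> 3 * card V"
proof (cases "total I F < 2 * card V")
  case True
  with assms show ?thesis unfolding short_circuits_def by fastforce
next
  case False
  with total_le[OF assms(2)] assms(3) have eq: "total I F = 2 * card V" by simp
  have fin: "finite I" using colouringD[OF assms(2)] by simp
  from assms(5) have "I \<noteq> {}" using assms(3) by auto
  then obtain i where i: "i \<in> I" by auto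
  have rest: "total (I - {i}) F \<le> 2 * card (I - {i})"
    by (rule total_le) (use assms(2) in \<open>auto simp: colouring_def\<close>)
  have tot: "total I F = card (F i) + total (I - {i}) F"
    using fin i by (simp add: sum.remove)
  have "card I \<noteq> 0" using fin i by auto
  then have two: "card (F i) = 2"
    using tot rest eq assms(3) i colouringD(5)[OF assms(2) i] by simp
  obtain f where f: "f \<in> F i" using colouringD(7)[OF assms(2) i] by auto
  define G where "G = F(i := {f})"
  have G: "colouring V I G"
    using assms(2) f i by (auto simp: colouring_def G_def)
  have "total (I - {i}) G = total (I - {i}) F"
    by (rule sum.cong) (auto simp: G_def)
  then have tG: "total I G = 2 * card V - 1"
    using fin i tot two eq by (simp add: sum.remove G_def)
  moreover have "card V \<noteq> 0" using assms(5) by auto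
  ultimately obtain vs where vs: "rainbow_circuit I G vs" "2 * length vs + total I G \<le> 3 * card V"
    using assms(1,3) G unfolding short_circuits_def by fastforce
  have "rainbow_circuit I F vs"
    by (rule rainbow_circuit_mono[OF vs(1)]) (use f in \<open>auto simp: G_def\<close>)
  with vs(2) tG assms(5) show ?thesis by (intro exI[of _ vs]) auto
qed

text \<open>Surplus colours go one at a time. Two single colours merge into a double one, which by
  disjointness preserves the total. With at most one single colour present, dropping any colour
  leaves a total of at least \<open>2 * card V - 1\<close>, hence at least \<open>m\<close>.\<close>

lemma short_circuits_disjoint:
  fixes F :: "'i \<Rightarrow> 'v set set"
  assumes "short_circuits TYPE('i) V" "colouring V I F" "card V \<le> card I"
    and "disjoint_family_on F I" "m \<le> total I F" "m < 2 * card V"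
  shows "\<exists>vs. rainbow_circuit I F vs \<and> 2 * length vs + m \<le> 3 * card V"
  using assms(2-)
proof (induction "card I" arbitrary: I F rule: less_induct)
  case less
  note fin = colouringD(2)[OF less.prems(1)]
  show ?case
  proof (cases "card I = card V")
    case True
    with short_circuitsD[OF assms(1)] less.prems show ?thesis by blast
  next
    case False
    with less.prems(2) have big: "card V < card I" by simp
    then have Ine: "I \<noteq> {}" by auto
    show ?thesis
    proof (cases "\<exists>i\<in>I. \<exists>j\<in>I. i \<noteq> j \<and> card (F i) = 1 \<and> card (F j) = 1")
      case True
      then obtain i j where ij: "i \<in> I" "j \<in> I" "i \<noteq> j" "card (F i) = 1" "card (F j) = 1" by auto
      define G where "G = F(i := F i \<union> F j)"
      have disj: "F i \<inter> F j = {}"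
        using less.prems(3) ij by (auto simp: disjoint_family_on_def)
      have cG: "card (G i) = 2"
        using ij disj by (auto simp: G_def card_Un_disjoint card_ge_0_finite)
      have col: "colouring V (I - {j}) G"
        unfolding colouring_def
      proof (intro conjI ballI)
        fix k assume k: "k \<in> I - {j}"
        show "G k \<subseteq> nsets V 2"
          using k ij colouringD(3)[OF less.prems(1)] by (auto simp: G_def)
        show "1 \<le> card (G k)" "card (G k) \<le> 2"
          using k cG colouringD(4,5)[OF less.prems(1)] by (cases "k = i"; auto simp: G_def)+
      qed (use less.prems(1) in \<open>auto dest: colouringD\<close>)
      have tot: "total (I - {j}) G = total I F"
      proof -
        have "total (I - {j}) G = card (G i) + total (I - {j} - {i}) G"
          using fin ij by (intro sum.remove) auto
        also have "total (I - {j} - {i}) G = total (I - {j} - {i}) F"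
          by (rule sum.cong) (auto simp: G_def)
        finally show ?thesis
          using fin ij cG sum.remove[of I j "\<lambda>i. card (F i)"]
            sum.remove[of "I - {j}" i "\<lambda>i. card (F i)"] by auto
      qed
      have "disjoint_family_on G (I - {j})"
        using less.prems(3) ij unfolding disjoint_family_on_def G_def by (auto split: if_splits)
      moreover have "card (I - {j}) < card I" "card V \<le> card (I - {j})"
        using fin ij big by (auto simp: card_Diff1_less)
      ultimately obtain vs where "rainbow_circuit (I - {j}) G vs" "2 * length vs + m \<le> 3 * card V"
        using less.hyps[of "I - {j}" G] col less.prems(4,5) tot by auto
      then show ?thesis
        unfolding G_def using rainbow_circuit_merge ij by metis
    next
      case False
      obtain i where i: "i \<in> I" using Ine by auto
      have col: "colouring V (I - {i}) F" for i
        using less.prems(1) by (auto simp: colouring_def)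
      have "2 * card I \<le> total I F + 1"
      proof (cases "\<exists>j\<in>I. card (F j) = 1")
        case True
        then obtain j where j: "j \<in> I" "card (F j) = 1" by auto
        have "2 \<le> card (F k)" if "k \<in> I - {j}" for k
        proof -
          have "card (F k) \<noteq> 1" using False j that by blast
          with colouringD(4)[OF less.prems(1), of k] that show ?thesis by simp
        qed
        then have "2 * card (I - {j}) \<le> total (I - {j}) F"
          using sum_bounded_below[of "I - {j}" 2 "\<lambda>i. card (F i)"] by (simp add: mult.commute)
        moreover have "total I F = card (F j) + total (I - {j}) F"
          using fin j(1) by (rule sum.remove)
        ultimately show ?thesis using j fin by (simp add: card_Diff_singleton)
      next
        case no: False
        have "2 \<le> card (F k)" if "k \<in> I" for k
        proof -
          have "card (F k) \<noteq> 1" using no that by blast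
          with colouringD(4)[OF less.prems(1), of k] that show ?thesis by simp
        qed
        then have "2 * card I \<le> total I F"
          using sum_bounded_below[of "I" 2 "\<lambda>i. card (F i)"] by (simp add: mult.commute)
        then show ?thesis by simp
      qed
      moreover have "total I F = card (F i) + total (I - {i}) F"
        using fin i by (rule sum.remove)
      moreover have "card (F i) \<le> 2" using colouringD(5)[OF less.prems(1) i] .
      ultimately have "m \<le> total (I - {i}) F" using big less.prems(5) by linarith
      moreover have "disjoint_family_on F (I - {i})"
        using less.prems(3) by (rule disjoint_family_on_mono[rotated]) auto
      moreover have "card (I - {i}) < card I" "card V \<le> card (I - {i})"
        using fin i big by (auto simp: card_Diff1_less)
      ultimately obtain vs where "rainbow_circuit (I - {i}) F vs" "2 * length vs + m \<le> 3 * card V"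
        using less.hyps[of "I - {i}" F] col less.prems(5) by auto
      then show ?thesis using rainbow_circuit_mono[of "I - {i}" F vs I F] by auto
    qed
  qed
qed

section \<open>Minimal counterexamples\<close>

text \<open>A circuit that misses the merged vertex \<open>x\<close> lifts unchanged. Otherwise its
  two edges there come from edges at \<open>x\<close> or \<open>y\<close>. If both come from the
  same end, that end takes the place of the merged vertex; if not, the edge \<open>{x, y}\<close> in
  the free colour \<open>c0\<close> is inserted between them, at the cost of one vertex.\<close>

lemma lift_contracted_circuit:
  fixes x y :: 'v
  defines "\<phi> \<equiv> \<lambda>v. if v = y then x else v"
  assumes "rainbow_circuit (I - {c0}) (\<lambda>i. (`) \<phi> ` F i) vs"
    and e: "x \<noteq> y" "c0 \<in> I" "{x, y} \<in> F c0"
    and F: "\<And>i f. i \<in> I - {c0} \<Longrightarrow> f \<in> F i \<Longrightarrow> card f = 2 \<and> f \<noteq> {x, y}"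
  shows "\<exists>ws. rainbow_circuit I F ws \<and> length ws \<le> length vs + 1"
proof -
  let ?G = "\<lambda>i. (`) \<phi> ` F i"
  have away: "f = g" if "\<phi> ` f = g" "x \<notin> g" for f g
    using that by (force simp: \<phi>_def image_iff split: if_splits)
  have at: "f = {x, w} \<or> f = {y, w}" if f: "i \<in> I - {c0}" "f \<in> F i" and im: "\<phi> ` f = {x, w}" for i f w
  proof -
    obtain a b where ab: "f = {a, b}" "a \<noteq> b" using F[OF f] by (auto simp: card_2_iff)
    have xf: "f \<noteq> {x, y}" using F[OF f] by simp
    show ?thesis
    proof (cases "y \<in> f")
      case True
      then obtain z where z: "f = {y, z}" "z \<noteq> y" using ab by fastforce
      then have "z \<noteq> x" using xf by auto
      moreover have "\<phi> ` f = {x, z}" using z by (simp add: \<phi>_def insert_commute)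
      ultimately have "z = w" using im by (simp add: doubleton_eq_iff)
      with z show ?thesis by simp
    next
      case False
      then have "\<phi> ` f = f" by (force simp: \<phi>_def)
      with im show ?thesis by simp
    qed
  qed
  have ny: "set vs \<subseteq> - {y}"
    by (rule rainbow_circuit_subset[OF assms(2)]) (use e(1) in \<open>auto simp: \<phi>_def split: if_splits\<close>)
  have keep: "list_all2 (\<lambda>e c. e \<in> F c) es cs" if "list_all2 (\<lambda>e c. e \<in> ?G c) es cs" "x \<notin> \<Union>(set es)" for es cs
  proof (rule list.rel_mono_strong[OF that(1)])
    fix e i assume "e \<in> set es" and e: "e \<in> ?G i"
    then have "x \<notin> e" using that(2) by auto
    with e show "e \<in> F i" using away by (metis imageE)
  qed
  show ?thesis
  proof (cases "x \<in> set vs")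
    case False
    obtain cs where cs: "distinct cs" "set cs \<subseteq> I - {c0}"
      "list_all2 (\<lambda>e c. e \<in> ?G c) (path_edges vs @ [{last vs, hd vs}]) cs"
      using assms(2) by (rule rainbow_circuitE)
    have vs: "2 \<le> length vs" "distinct vs" using assms(2) by (auto simp: rainbow_circuit_def)
    then have "vs \<noteq> []" by auto
    then have "{last vs, hd vs} \<subseteq> set vs" by simp
    then have "x \<notin> \<Union>(set (path_edges vs @ [{last vs, hd vs}]))"
      using set_path_edges_subset[of _ vs] False by fastforce
    with cs(3) have "list_all2 (\<lambda>e c. e \<in> F c) (path_edges vs @ [{last vs, hd vs}]) cs" by (rule keep)
    with cs vs have "rainbow_circuit I F vs"
      unfolding rainbow_circuit_def rainbow_iff by auto
    then show ?thesis by auto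
  next
    case True
    then obtain as bs where split: "vs = as @ x # bs" by (auto simp: in_set_conv_decomp)
    define ws where "ws = bs @ as"
    have circ: "rainbow_circuit (I - {c0}) ?G (x # ws)"
      using assms(2) rainbow_circuit_append_commute[of "I - {c0}" ?G as "x # bs"]
      by (simp add: split ws_def)
    then have ne: "ws \<noteq> []" by (auto simp: rainbow_circuit_def)
    have len: "length (x # ws) = length vs" by (simp add: split ws_def)
    from circ ne have ws: "x \<notin> set ws" "distinct ws" by (auto simp: rainbow_circuit_def)
    have yws: "y \<notin> set ws" using ny by (auto simp: split ws_def)
    obtain c cs d where *: "distinct (c # cs @ [d])" "set (c # cs @ [d]) \<subseteq> I - {c0}"
      "{x, hd ws} \<in> ?G c" "list_all2 (\<lambda>e c. e \<in> ?G c) (path_edges ws) cs" "{last ws, x} \<in> ?G d"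
      using circ unfolding rainbow_circuit_Cons[OF ne] by auto
    have path: "list_all2 (\<lambda>e c. e \<in> F c) (path_edges ws) cs"
      using *(4) by (rule keep) (use ws(1) set_path_edges_subset in fastforce)
    obtain f where f: "f \<in> F c" "\<phi> ` f = {x, hd ws}" using *(3) by auto
    obtain g where g: "g \<in> F d" "\<phi> ` g = {x, last ws}" using *(5) by (auto simp: insert_commute)
    have "f = {x, hd ws} \<or> f = {y, hd ws}" using at[of c f "hd ws"] f *(2) by auto
    moreover have "g = {x, last ws} \<or> g = {y, last ws}" using at[of d g "last ws"] g *(2) by auto
    ultimately consider "{x, hd ws} \<in> F c" "{x, last ws} \<in> F d"
      | "{y, hd ws} \<in> F c" "{y, last ws} \<in> F d"
      | "{y, hd ws} \<in> F c" "{x, last ws} \<in> F d"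
      | "{x, hd ws} \<in> F c" "{y, last ws} \<in> F d"
      using f g by blast
    then show ?thesis
    proof cases
      case 1
      then have "rainbow_circuit I F (x # ws)"
        unfolding rainbow_circuit_Cons[OF ne] using *(1,2) ws path
        by (intro conjI exI[of _ c] exI[of _ cs] exI[of _ d]) (auto simp: insert_commute)
      with len show ?thesis by (intro exI[of _ "x # ws"]) auto
    next
      case 2
      then have "rainbow_circuit I F (y # ws)"
        unfolding rainbow_circuit_Cons[OF ne] using *(1,2) ws yws path
        by (intro conjI exI[of _ c] exI[of _ cs] exI[of _ d]) (auto simp: insert_commute)
      with len show ?thesis by (intro exI[of _ "y # ws"]) auto
    next
      case 3
      then have "rainbow_circuit I F (x # y # ws)"
        using *(1,2) ws yws path e ne
        by (subst rainbow_circuit_Cons)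
          (simp, intro conjI exI[of _ c0] exI[of _ "c # cs"] exI[of _ d],
            auto simp: insert_commute path_edges_Cons)
      with len show ?thesis by (intro exI[of _ "x # y # ws"]) auto
    next
      case 4
      then have "rainbow_circuit I F (y # x # ws)"
        using *(1,2) ws yws path e ne
        by (subst rainbow_circuit_Cons)
          (simp, intro conjI exI[of _ c0] exI[of _ "c # cs"] exI[of _ d],
            auto simp: insert_commute path_edges_Cons)
      with len show ?thesis by (intro exI[of _ "y # x # ws"]) auto
    qed
  qed
qed

section \<open>Disjointness of the colours and deletion of vertices\<close>

locale minimal_counterexample =
  fixes V :: "'v set" and I :: "'i set" and F :: "'i \<Rightarrow> 'v set set"
  assumes col: "colouring V I F" and card_I: "card I = card V"
    and total_less: "total I F < 2 * card V"
    and long: "rainbow_circuit I F vs \<Longrightarrow> 3 * card V < 2 * length vs + total I F"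
    and smaller: "W \<subset> V \<Longrightarrow> short_circuits TYPE('i) W"
begin

lemmas finV = colouringD(1)[OF col]
  and finI = colouringD(2)[OF col]
  and nsetsF = colouringD(3)[OF col]
  and F_ge1 = colouringD(4)[OF col]
  and F_le2 = colouringD(5)[OF col]
  and finF = colouringD(6)[OF col]
  and edge_subset = colouringD(8)[OF col]
  and edge_card = colouringD(9)[OF col]

definition edges :: "'v set set" where "edges = (\<Union>i\<in>I. F i)"

definition cnt :: "('v set \<Rightarrow> bool) \<Rightarrow> nat" where
  "cnt P = card {f \<in> edges. P f}"

text \<open>An edge in two colours is a circuit of length 2. That it is not short enough forces
  \<open>card V = 2\<close> and a total above 2. But two vertices carry one edge, so all colours are
  single and the total is at most 2.\<close>

lemma colour_unique:
  assumes "i \<in> I" "j \<in> I" "f \<in> F i" "f \<in> F j"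
  shows "i = j"
proof (rule ccontr)
  assume "i \<noteq> j"
  obtain u v where f: "f = {u, v}" "u \<noteq> v"
    using edge_card[OF assms(1,3)] by (auto simp: card_2_iff)
  have uv: "{u, v} \<subseteq> V" using edge_subset[OF assms(1,3)] f by simp
  have "rainbow I F [{u, v}, {v, u}]"
    unfolding rainbow_iff
    by (rule exI[of _ "[i, j]"]) (use assms f \<open>i \<noteq> j\<close> in \<open>auto simp: insert_commute\<close>)
  then have "rainbow_circuit I F [u, v]"
    using f by (simp add: rainbow_circuit_def)
  from long[OF this] have "card V \<le> 2" "3 * card V < 4 + total I F" using total_less by auto
  moreover have "2 \<le> card V" using card_mono[OF finV uv] f by simp
  ultimately have two: "card V = 2" "2 < total I F" by auto
  have V: "V = {u, v}" using card_subset_eq[OF finV uv] two f by simp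
  have "F i \<subseteq> {V}" if "i \<in> I" for i
  proof
    fix g assume "g \<in> F i"
    then have "g \<subseteq> V" "card g = 2" using that edge_subset edge_card by auto
    then show "g \<in> {V}" using card_subset_eq[OF finV] two by auto
  qed
  then have "card (F i) \<le> 1" if "i \<in> I" for i
    using that card_mono[of "{V}" "F i"] by auto
  then have "total I F \<le> card I"
    using sum_bounded_above[of I "\<lambda>i. card (F i)" 1] by simp
  with two card_I show False by simp
qed

lemma disjoint: "J \<subseteq> I \<Longrightarrow> disjoint_family_on F J"
  unfolding disjoint_family_on_def using colour_unique by blast

lemma finite_edges: "finite edges"
  using finI finF by (auto simp: edges_def)

lemma edgesE:
  assumes "f \<in> edges"
  obtains i where "i \<in> I" "f \<in> F i"
  using assms by (auto simp: edges_def)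

lemma edgesI: "i \<in> I \<Longrightarrow> f \<in> F i \<Longrightarrow> f \<in> edges"
  by (auto simp: edges_def)

lemma edges_card: "f \<in> edges \<Longrightarrow> card f = 2"
  and edges_subset: "f \<in> edges \<Longrightarrow> f \<subseteq> V"
  by (auto simp: edges_def dest: edge_card edge_subset)

lemma sum_edges: "(\<Sum>f\<in>edges. g f) = (\<Sum>i\<in>I. \<Sum>f\<in>F i. g f)"
  unfolding edges_def using finI finF colour_unique
  by (intro sum.UNION_disjoint) auto

lemma cnt_sum: "cnt P = (\<Sum>f\<in>edges. if P f then 1 else 0)"
  using finite_edges by (simp add: cnt_def sum.If_cases Int_def)

lemma cnt_colours: "cnt P = (\<Sum>i\<in>I. card {f \<in> F i. P f})"
  unfolding cnt_sum sum_edges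
  by (rule sum.cong) (use finF in \<open>auto simp: sum.If_cases Int_def\<close>)

lemma card_edges: "card edges = total I F"
  using cnt_colours[of "\<lambda>_. True"] by (simp add: cnt_def)

lemma cnt_compl: "cnt (\<lambda>f. \<not> P f) + cnt P = total I F"
proof -
  have "card ({f \<in> edges. \<not> P f} \<union> {f \<in> edges. P f}) = cnt (\<lambda>f. \<not> P f) + cnt P"
    unfolding cnt_def using finite_edges by (intro card_Un_disjoint) auto
  moreover have "{f \<in> edges. \<not> P f} \<union> {f \<in> edges. P f} = edges" by auto
  ultimately show ?thesis by (simp add: card_edges)
qed

text \<open>The colours that die when \<open>Z\<close> is deleted.\<close>

definition hit :: "'v set \<Rightarrow> 'i set" where
  "hit Z = {i \<in> I. \<forall>f\<in>F i. f \<inter> Z \<noteq> {}}"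

text \<open>If too few colours were hit by \<open>Z\<close>, the colours surviving on \<open>V - Z\<close> would already contain
  a circuit that is short enough.\<close>

lemma card_hit:
  assumes "Z \<subset> V" "Z \<noteq> {}" "cnt (\<lambda>f. f \<inter> Z \<noteq> {}) \<le> 3 * card Z"
  shows "card Z < card (hit Z)"
proof (rule ccontr)
  assume "\<not> card Z < card (hit Z)"
  then have less: "card (hit Z) \<le> card Z" by simp
  define J where "J = I - hit Z"
  define G where "G i = {f \<in> F i. f \<inter> Z = {}}" for i
  have finZ: "finite Z" using assms(1) finV by (auto intro: finite_subset)
  have hitI: "hit Z \<subseteq> I" by (auto simp: hit_def)
  have cV: "card (V - Z) = card V - card Z" "card Z < card V" "0 < card Z"
    using assms finV finZ by (auto simp: card_Diff_subset psubset_card_mono card_gt_0_iff)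
  have cJ: "card J = card I - card (hit Z)"
    unfolding J_def using hitI finI by (intro card_Diff_subset) (auto intro: finite_subset)
  have G: "colouring (V - Z) J G"
    unfolding colouring_def
  proof (intro conjI ballI)
    fix i assume i: "i \<in> J"
    then have iI: "i \<in> I" and ne: "G i \<noteq> {}" by (auto simp: J_def hit_def G_def)
    have sub: "G i \<subseteq> F i" by (auto simp: G_def)
    then show "card (G i) \<le> 2" using F_le2[OF iI] card_mono[OF finF[OF iI] sub] by simp
    show "1 \<le> card (G i)"
      using ne sub finF[OF iI] by (simp add: Suc_le_eq card_gt_0_iff finite_subset)
    show "G i \<subseteq> nsets (V - Z) 2"
      using nsetsF[OF iI] by (auto simp: G_def nsets_def)
  qed (use finV finI in \<open>auto simp: J_def\<close>)
  have "total J G = total I G"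
  proof (rule sum.mono_neutral_left)
    show "\<forall>i\<in>I - J. card (G i) = 0"
    proof
      fix i assume "i \<in> I - J"
      then have "G i = {}" by (auto simp: J_def hit_def G_def)
      then show "card (G i) = 0" by simp
    qed
  qed (use finI in \<open>auto simp: J_def\<close>)
  also have "\<dots> = cnt (\<lambda>f. f \<inter> Z = {})" by (simp add: cnt_colours G_def)
  finally have "total J G + cnt (\<lambda>f. f \<inter> Z \<noteq> {}) = total I F"
    using cnt_compl[of "\<lambda>f. f \<inter> Z = {}"] by simp
  \<comment> \<open>This lower bound makes both sides of the length estimate drop by
    \<open>3 * card Z\<close>, so a circuit short enough for \<open>V - Z\<close> is short enough
    for \<open>V\<close>.\<close>
  then have "total I F - 3 * card Z \<le> total J G" using assms(3) by simp
  moreover have "total I F - 3 * card Z < 2 * card (V - Z)" using total_less cV by simp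
  moreover have "card (V - Z) \<le> card J" using cJ cV less card_I by simp
  moreover have "disjoint_family_on G J"
    using disjoint[of J] by (auto simp: disjoint_family_on_def G_def J_def)
  ultimately obtain vs where vs: "rainbow_circuit J G vs"
    "2 * length vs + (total I F - 3 * card Z) \<le> 3 * card (V - Z)"
    using short_circuits_disjoint[OF smaller G] assms(1,2) by blast
  have "rainbow_circuit I F vs"
    using vs(1) by (rule rainbow_circuit_mono) (auto simp: J_def G_def)
  from long[OF this] vs(2) cV show False by simp
qed

section \<open>Degrees, stars and double counting\<close>

definition deg :: "'v \<Rightarrow> nat" where "deg v = cnt (\<lambda>f. v \<in> f)"

definition stars :: "'v \<Rightarrow> 'i set" where "stars v = {i \<in> I. \<forall>f\<in>F i. v \<in> f}"

text \<open>Counting a single edge twice gives every colour the same weight 4.\<close>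

definition weight :: "'i \<Rightarrow> 'v \<Rightarrow> nat" where
  "weight i v = (if card (F i) = 1 then 2 else 1) * card {f \<in> F i. v \<in> f}"

lemma hit_single: "hit {v} = stars v"
  by (auto simp: hit_def stars_def)

lemma sum_incidence:
  assumes "f \<in> edges"
  shows "(\<Sum>v\<in>V. if v \<in> f then 1 else 0 :: nat) = 2"
  using assms edges_card edges_subset finV
  by (auto simp: sum.If_cases Int_absorb1 Int_def[symmetric])

lemma sum_weight:
  assumes "i \<in> I"
  shows "(\<Sum>v\<in>V. weight i v) = 4"
proof -
  have "(\<Sum>v\<in>V. card {f \<in> F i. v \<in> f}) = (\<Sum>v\<in>V. \<Sum>f\<in>F i. if v \<in> f then 1 else 0)"
    using finF[OF assms] by (intro sum.cong) (auto simp: sum.If_cases Int_def)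
  also have "\<dots> = (\<Sum>f\<in>F i. \<Sum>v\<in>V. if v \<in> f then 1 else 0)"
    by (rule sum.swap)
  also have "\<dots> = (\<Sum>f\<in>F i. 2)"
    using assms by (intro sum.cong sum_incidence edgesI) auto
  finally have "(\<Sum>v\<in>V. weight i v) = (if card (F i) = 1 then 2 else 1) * (2 * card (F i))"
    by (simp add: weight_def sum_distrib_left[symmetric])
  with F_ge1[OF assms] F_le2[OF assms] show ?thesis by (auto split: if_splits)
qed

lemma weight_star:
  assumes "i \<in> stars v"
  shows "weight i v = 2"
proof -
  have "{f \<in> F i. v \<in> f} = F i" "i \<in> I" using assms by (auto simp: stars_def)
  with F_ge1[of i] F_le2[of i] show ?thesis by (auto simp: weight_def)
qed

lemma deg_le_weight: "deg v \<le> (\<Sum>i\<in>I. weight i v)"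
  unfolding deg_def cnt_colours by (rule sum_mono) (auto simp: weight_def)

lemma finite_stars: "finite (stars v)"
  using finI by (simp add: stars_def)

lemma sum_weight_stars: "(\<Sum>i\<in>I. weight i v) = 2 * card (stars v) + (\<Sum>i\<in>I - stars v. weight i v)"
proof -
  have "(\<Sum>i\<in>I. weight i v) = (\<Sum>i\<in>I - stars v. weight i v) + (\<Sum>i\<in>stars v. weight i v)"
    using finI by (intro sum.subset_diff) (auto simp: stars_def)
  moreover have "(\<Sum>i\<in>stars v. weight i v) = 2 * card (stars v)"
    using weight_star by simp
  ultimately show ?thesis by simp
qed

text \<open>The colours are disjoint, so there are at least \<open>card V\<close> distinct edges,
  more than one or two vertices have pairs.\<close>

lemma card_V_ge3: "3 \<le> card V"
proof -
  have "card V \<noteq> 0" using total_less by auto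
  have tot: "card V \<le> total I F" using total_ge[OF col] card_I by simp
  have "edges \<subseteq> nsets V 2" using nsetsF by (auto simp: edges_def)
  then have "card edges \<le> card V choose 2"
    using finV by (metis card_mono card_nsets finite_imp_finite_nsets)
  then have "card V \<le> card V choose 2" using tot card_edges by simp
  with \<open>card V \<noteq> 0\<close> show ?thesis
    by (cases "card V = 1 \<or> card V = 2") (auto simp: numeral_2_eq_2)
qed

lemma small_degree_stars:
  assumes "v \<in> V" "deg v \<le> 3"
  shows "2 \<le> card (stars v)"
proof -
  have "{v} \<subset> V" using assms card_V_ge3 by auto
  then show ?thesis
    using card_hit[of "{v}"] assms(2) by (simp add: hit_single deg_def)
qed

text \<open>Each vertex has weight at least 4: its degree is at least 4, or it has two stars of
  weight 2 each. Summed by colours the weights give \<open>4 * card I\<close>, which is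
  \<open>4 * card V\<close>, so no vertex exceeds 4.\<close>

lemma weight_eq_4:
  assumes "v \<in> V"
  shows "(\<Sum>i\<in>I. weight i v) = 4"
proof -
  have ge: "4 \<le> (\<Sum>i\<in>I. weight i v)" if "v \<in> V" for v
  proof (cases "deg v \<le> 3")
    case True
    with small_degree_stars[OF that] sum_weight_stars[of v] show ?thesis by simp
  qed (use deg_le_weight[of v] in simp)
  have "(\<Sum>v\<in>V. \<Sum>i\<in>I. weight i v) = (\<Sum>i\<in>I. \<Sum>v\<in>V. weight i v)"
    by (rule sum.swap)
  also have "\<dots> = (\<Sum>v\<in>V. 4)" using sum_weight card_I by simp
  finally have eq: "(\<Sum>v\<in>V. 4) = (\<Sum>v\<in>V. \<Sum>i\<in>I. weight i v)" by simp
  from sum_mono_inv[OF eq ge assms finV] show ?thesis by simp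
qed

text \<open>Two stars already exhaust the weight 4, which leaves no room for a third star or for a
  colour that is only partly at \<open>v\<close>.\<close>

lemma
  assumes "v \<in> V" "deg v \<le> 3"
  shows card_stars_eq_2: "card (stars v) = 2"
    and colours_at_star: "i \<in> I \<Longrightarrow> f \<in> F i \<Longrightarrow> v \<in> f \<Longrightarrow> i \<in> stars v"
proof -
  have *: "2 * card (stars v) + (\<Sum>i\<in>I - stars v. weight i v) = 4" "2 \<le> card (stars v)"
    using weight_eq_4[OF assms(1)] sum_weight_stars[of v] small_degree_stars[OF assms] by simp_all
  then show "card (stars v) = 2" by simp
  have zero: "(\<Sum>i\<in>I - stars v. weight i v) = 0" using * by simp
  assume i: "i \<in> I" "f \<in> F i" "v \<in> f"
  show "i \<in> stars v"
  proof (rule ccontr)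
    assume "i \<notin> stars v"
    then have "weight i v = 0" using zero i finI by simp
    then have "card {f \<in> F i. v \<in> f} = 0" by (simp add: weight_def split: if_splits)
    then show False using i finF[OF i(1)] by auto
  qed
qed


section \<open>Contraction of a single edge\<close>

lemma single_colour: "\<exists>i\<in>I. card (F i) = 1"
proof (rule ccontr)
  assume "\<not> ?thesis"
  then have "2 \<le> card (F i)" if "i \<in> I" for i
    using that F_ge1[of i] by (metis One_nat_def le_antisym not_less_eq_eq numeral_2_eq_2)
  then have "2 * card I \<le> total I F"
    using sum_bounded_below[of I 2 "\<lambda>i. card (F i)"] by (simp add: mult.commute)
  with card_I total_less show False by simp
qed

text \<open>The single edge counts twice in the weight 4 but only once in the degree.\<close>

lemma deg_single_end:
  assumes "c \<in> I" "F c = {e}" "v \<in> e"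
  shows "deg v \<le> 3"
proof -
  have v: "v \<in> V" using assms edge_subset by auto
  have "deg v = card {f \<in> F c. v \<in> f} + (\<Sum>i\<in>I - {c}. card {f \<in> F i. v \<in> f})"
    unfolding deg_def cnt_colours using finI assms(1) by (rule sum.remove)
  also have "{f \<in> F c. v \<in> f} = {e}" using assms by auto
  also have "(\<Sum>i\<in>I - {c}. card {f \<in> F i. v \<in> f}) \<le> (\<Sum>i\<in>I - {c}. weight i v)"
    by (rule sum_mono) (auto simp: weight_def)
  also have "(\<Sum>i\<in>I - {c}. weight i v) + weight c v = 4"
    using weight_eq_4[OF v] finI assms(1) by (simp add: sum.remove)
  moreover have "weight c v = 2" using assms by (intro weight_star) (auto simp: stars_def)
  ultimately show ?thesis by simp
qed

text \<open>Contracting a single edge loses one vertex, one colour and one edge, and lengthens circuits by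
  at most one when undone; this contradicts minimality except in one case of parity. No colour
  degenerates, because all colours at \<open>x\<close> have all their edges at \<open>x\<close>.\<close>

lemma contraction_bound:
  assumes c: "c \<in> I" "F c = {{x, y}}" "x \<noteq> y"
  shows "total I F = 2 * card V - 1" "even (card V)"
proof -
  have xy: "x \<in> V" "y \<in> V" using edge_subset c by auto
  define \<phi> where "\<phi> v = (if v = y then x else v)" for v
  define G where "G i = (`) \<phi> ` F i" for i
  define W where "W = V - {y}"
  define J where "J = I - {c}"
  have W: "W \<subset> V" "card W = card V - 1" using xy finV by (auto simp: W_def)
  have J: "card J = card I - 1" "J \<subseteq> I" using c by (auto simp: J_def)
  have not_e: "f \<noteq> {x, y}" if "i \<in> J" "f \<in> F i" for i f
    using colour_unique[of i c f] that c by (auto simp: J_def)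
  have img: "\<phi> ` f \<in> nsets W 2" if f: "i \<in> J" "f \<in> F i" for i f
  proof -
    have iI: "i \<in> I" using f by (simp add: J_def)
    obtain a b where ab: "f = {a, b}" "a \<noteq> b" using edge_card[OF iI f(2)] by (auto simp: card_2_iff)
    have "a \<in> V" "b \<in> V" using edge_subset[OF iI f(2)] ab by auto
    then have "\<phi> a \<in> W" "\<phi> b \<in> W" using xy c(3) by (auto simp: W_def \<phi>_def)
    moreover have "\<phi> a \<noteq> \<phi> b" using not_e[OF f] ab by (auto simp: \<phi>_def split: if_splits)
    ultimately show ?thesis using ab by (simp add: nsets_def)
  qed
  have deg_x: "deg x \<le> 3" by (rule deg_single_end[OF c(1,2)]) simp
  have at_x: "i \<in> stars x" if "i \<in> I" "f \<in> F i" "x \<in> f" for i f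
    using colours_at_star[OF xy(1) deg_x] that by auto
  \<comment> \<open>Two edges of one colour both contain \<open>x\<close>, where
    \<open>\<phi>\<close> fixes them, or both avoid \<open>x\<close>, where \<open>\<phi>\<close> is
    injective.\<close>
  have inj: "inj_on ((`) \<phi>) (F i)" if i: "i \<in> J" for i
  proof (rule inj_onI)
    fix f g assume fg: "f \<in> F i" "g \<in> F i" "\<phi> ` f = \<phi> ` g"
    have iI: "i \<in> I" using i by (simp add: J_def)
    show "f = g"
    proof (cases "x \<in> f")
      case True
      then have xg: "x \<in> g" using at_x[OF iI fg(1)] fg by (auto simp: stars_def)
      have id: "\<phi> ` h = h" if h: "h \<in> F i" "x \<in> h" for h
      proof -
        have "y \<notin> h"
        proof
          assume "y \<in> h"
          with h c(3) edge_card[OF iI h(1)] have "h = {x, y}"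
            by (auto simp: card_2_iff)
          with not_e[OF i h(1)] show False by simp
        qed
        then show ?thesis by (force simp: \<phi>_def)
      qed
      show ?thesis using id[OF fg(1) True] id[OF fg(2) xg] fg(3) by metis
    next
      case False
      then have "x \<notin> g" using at_x[OF iI fg(2)] fg by (auto simp: stars_def)
      moreover have "inj_on \<phi> (- {x})" by (auto simp: inj_on_def \<phi>_def)
      ultimately show ?thesis using False fg(3) inj_on_image_eq_iff[of \<phi> "- {x}" f g] by auto
    qed
  qed
  have card_G: "card (G i) = card (F i)" if "i \<in> J" for i
    using inj[OF that] by (simp add: G_def card_image)
  have G: "colouring W J G"
    unfolding colouring_def
  proof (intro conjI ballI)
    fix i assume i: "i \<in> J"
    then show "1 \<le> card (G i)" "card (G i) \<le> 2"
      using card_G[OF i] F_ge1[of i] F_le2[of i] by (auto simp: J_def)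
    show "G i \<subseteq> nsets W 2" using img i by (auto simp: G_def)
  qed (use finV finI in \<open>auto simp: W_def J_def\<close>)
  have "total J G = total J F" using card_G by simp
  moreover have "total I F = card (F c) + total J F"
    unfolding J_def using finI c(1) by (rule sum.remove)
  ultimately have tot: "total J G = total I F - 1" "0 < total I F" using c by auto
  have cardV: "3 \<le> card V" by (rule card_V_ge3)
  \<comment> \<open>The cap \<open>2 * card V - 3\<close> is \<open>2 * card W - 1\<close>, the
    largest value that \<open>short_circuitsD\<close> admits.\<close>
  define m where "m = min (total J G) (2 * card V - 3)"
  obtain vs where vs: "rainbow_circuit J G vs" "2 * length vs + m \<le> 3 * card W"
  proof -
    have "card J = card W" "m \<le> total J G" "m < 2 * card W"
      using W J card_I cardV by (auto simp: m_def)
    from short_circuitsD[OF smaller[OF W(1)] G this] that show thesis by blast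
  qed
  obtain ws where ws: "rainbow_circuit I F ws" "length ws \<le> length vs + 1"
  proof -
    have "\<phi> = (\<lambda>v. if v = y then x else v)" by (simp add: fun_eq_iff \<phi>_def)
    then have "rainbow_circuit (I - {c}) (\<lambda>i. (`) (\<lambda>v. if v = y then x else v) ` F i) vs"
      using vs(1) by (simp add: J_def G_def[abs_def])
    then have "\<exists>ws. rainbow_circuit I F ws \<and> length ws \<le> length vs + 1"
      by (rule lift_contracted_circuit[of I c y x F vs])
        (use c not_e edge_card in \<open>auto simp: J_def\<close>)
    then show thesis using that by blast
  qed
  have *: "3 * card V < 2 * length vs + 2 + total I F" using long[OF ws(1)] ws(2) by simp
  have **: "2 * length vs + m + 3 \<le> 3 * card V" using vs(2) W cardV by simp
  \<comment> \<open>For a smaller total \<open>m\<close> would be \<open>total I F - 1\<close>, and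
    the two estimates would contradict each other. At the maximal total they pin
    \<open>card V\<close> to \<open>2 * length vs\<close>.\<close>
  show tV: "total I F = 2 * card V - 1"
    using * ** tot total_less cardV unfolding m_def by linarith
  then have "m = 2 * card V - 3" using tot unfolding m_def by simp
  then have "2 * length vs \<le> card V" "card V < 2 * length vs + 1 + (0::nat)"
    using * ** tV cardV by linarith+
  then have "card V = 2 * length vs" by simp
  then show "even (card V)" by simp
qed

text \<open>The total is only one short of its maximum \<open>2 * card I\<close>, and
  \<open>c\<close> accounts for that deficit.\<close>

lemma double_if_not_single:
  assumes c: "c \<in> I" "F c = {{x, y}}" "x \<noteq> y" and i: "i \<in> I" "i \<noteq> c"
  shows "card (F i) = 2"
proof -
  have "total I F = card (F c) + total (I - {c}) F"
    using finI c(1) by (rule sum.remove)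
  then have "total (I - {c}) F + 2 = 2 * card I"
    using contraction_bound(1)[OF c] card_I card_V_ge3 c by simp
  moreover have "card (I - {c}) + 1 = card I"
    using c(1) finI card_Suc_Diff1 by fastforce
  ultimately have eq: "total (I - {c}) F = (\<Sum>i\<in>I - {c}. 2)" by simp
  show ?thesis
    using sum_mono_inv[OF eq] F_le2 finI i by auto
qed

end

section \<open>The case of a unique single edge\<close>

text \<open>The shape into which every minimal counterexample is brought at the end:
  \<open>c\<close> and \<open>d\<close> are the two stars at the end \<open>x\<close> of a single
  edge, and contraction has shown that the number of vertices is even.\<close>

locale critical_counterexample = minimal_counterexample V I F
  for V :: "'v set" and I :: "'i set" and F :: "'i \<Rightarrow> 'v set set" +
  fixes c d :: 'i and x y p q :: 'v and h :: nat
  assumes c: "c \<in> I" "F c = {{x, y}}" "x \<noteq> y"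
    and d: "d \<in> I" "d \<noteq> c" "F d = {{x, p}, {x, q}}" "p \<noteq> q"
    and card_V: "card V = 2 * h"
begin

lemma total_eq: "total I F + 1 = 4 * h"
  using contraction_bound(1)[OF c] card_V card_V_ge3 by simp

lemma circuit_long: "rainbow_circuit I F vs \<Longrightarrow> h < length vs"
  using long[of vs] total_eq card_V by simp

lemmas double = double_if_not_single[OF c]

text \<open>For \<open>h = 2\<close> there would be 7 distinct edges among the 6 pairs of 4
  vertices.\<close>

lemma h_ge3: "3 \<le> h"
proof (rule ccontr)
  assume "\<not> 3 \<le> h"
  then have "h = 2" using card_V card_V_ge3 by simp
  have "edges \<subseteq> nsets V 2" using nsetsF by (auto simp: edges_def)
  then have "card edges \<le> card V choose 2"
    using finV by (metis card_mono card_nsets finite_imp_finite_nsets)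
  then show False
    using \<open>h = 2\<close> total_eq card_V card_edges by (simp add: choose_two)
qed

lemma vertices: "x \<in> V" "y \<in> V" "p \<in> V" "q \<in> V"
  using edge_subset c d by auto

lemma distinct_vertices: "p \<noteq> x" "q \<noteq> x" "p \<noteq> y" "q \<noteq> y"
proof -
  have "{x, p} \<in> F d" "{x, q} \<in> F d" using d by auto
  then have "card {x, p} = 2" "card {x, q} = 2" using edge_card d(1) by auto
  then show "p \<noteq> x" "q \<noteq> x" by auto
  have "{x, y} \<notin> F d" using colour_unique[of c d "{x, y}"] c d by auto
  then show "p \<noteq> y" "q \<noteq> y" using d(3) by auto
qed

lemma deg_eq:
  assumes "v \<in> V"
  shows "deg v + (if v = x \<or> v = y then 1 else 0) = 4"
proof -
  have "(\<Sum>i\<in>I - {c}. weight i v) = (\<Sum>i\<in>I - {c}. card {f \<in> F i. v \<in> f})"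
    by (rule sum.cong) (auto simp: weight_def double)
  moreover have "(\<Sum>i\<in>I. weight i v) = weight c v + (\<Sum>i\<in>I - {c}. weight i v)"
    using finI c(1) by (rule sum.remove)
  moreover have "deg v = card {f \<in> F c. v \<in> f} + (\<Sum>i\<in>I - {c}. card {f \<in> F i. v \<in> f})"
    unfolding deg_def cnt_colours using finI c(1) by (rule sum.remove)
  moreover have "weight c v = 2 * card {f \<in> F c. v \<in> f}" using c(2) by (simp add: weight_def)
  ultimately have "deg v + card {f \<in> F c. v \<in> f} = 4" using weight_eq_4[OF assms] by linarith
  moreover have "{f \<in> F c. v \<in> f} = (if v = x \<or> v = y then {{x, y}} else {})"
    using c by auto
  ultimately show ?thesis by (auto split: if_splits)
qed

text \<open>\<open>c\<close> and \<open>d\<close> are already the two stars at \<open>x\<close>, and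
  a vertex of degree at most 3 meets no colours but its stars.\<close>

lemma colours_at_x:
  assumes "i \<in> I" "f \<in> F i" "x \<in> f"
  shows "i = c \<or> i = d"
proof -
  have deg: "deg x \<le> 3" using deg_eq[OF vertices(1)] by simp
  have "{c, d} \<subseteq> stars x" using c d by (auto simp: stars_def)
  moreover have "card {c, d} = 2" using d by simp
  ultimately have "stars x = {c, d}"
    using card_subset_eq[OF finite_stars] card_stars_eq_2[OF vertices(1) deg] by metis
  with colours_at_star[OF vertices(1) deg assms] show ?thesis by auto
qed

lemma sum_deg:
  assumes "Y \<subseteq> V"
  shows "(\<Sum>v\<in>Y. deg v) = cnt (\<lambda>f. f \<inter> Y \<noteq> {}) + cnt (\<lambda>f. f \<subseteq> Y)"
proof -
  have finY: "finite Y" using assms finV by (rule finite_subset)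
  have "(\<Sum>v\<in>Y. deg v) = (\<Sum>f\<in>edges. \<Sum>v\<in>Y. if v \<in> f then 1 else 0)"
    unfolding deg_def cnt_sum by (rule sum.swap)
  also have "\<dots> = (\<Sum>f\<in>edges. (if f \<inter> Y \<noteq> {} then 1 else 0) + (if f \<subseteq> Y then 1 else 0))"
  proof (rule sum.cong)
    fix f assume "f \<in> edges"
    then have "card f = 2" by (rule edges_card)
    then obtain a b where "f = {a, b}" "a \<noteq> b" by (auto simp: card_2_iff)
    moreover have "(\<Sum>v\<in>Y. if v \<in> f then 1 else 0) = card (Y \<inter> f)"
      using finY by (simp add: sum.If_cases Int_def)
    ultimately show "(\<Sum>v\<in>Y. if v \<in> f then 1 else 0) =
        (if f \<inter> Y \<noteq> {} then 1 else 0) + (if f \<subseteq> Y then 1 else (0::nat))"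
      by (cases "a \<in> Y"; cases "b \<in> Y") auto
  qed simp
  finally show ?thesis by (simp add: cnt_sum sum.distrib)
qed

section \<open>Colours inside a vertex set and balls around \<open>y\<close>\<close>

definition inner :: "'v set \<Rightarrow> 'i set" where
  "inner Y = {i \<in> I. \<forall>f\<in>F i. f \<subseteq> Y}"

lemma inner_mono: "Y \<subseteq> Z \<Longrightarrow> inner Y \<subseteq> inner Z"
  by (auto simp: inner_def)

lemma colouring_inner:
  assumes "Y \<subseteq> V" "J \<subseteq> inner Y"
  shows "colouring Y J F"
  unfolding colouring_def
proof (intro conjI ballI)
  show "finite Y" "finite J"
    using assms finV finI by (auto simp: inner_def intro: finite_subset)
  fix i assume "i \<in> J"
  then have i: "i \<in> I" "\<forall>f\<in>F i. f \<subseteq> Y" using assms by (auto simp: inner_def)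
  then show "F i \<subseteq> nsets Y 2" "1 \<le> card (F i)" "card (F i) \<le> 2"
    using nsetsF[OF i(1)] F_ge1[OF i(1)] F_le2[OF i(1)] by (auto simp: nsets_def)
qed

lemma total_double: "J \<subseteq> I - {c} \<Longrightarrow> total J F = 2 * card J"
  using double by (subst sum.cong[OF refl, of J _ "\<lambda>_. 2"]) auto

text \<open>As many double colours inside \<open>Y\<close> as vertices would give a circuit of
  length at most \<open>(card Y + 1) / 2\<close>, which is at most \<open>h\<close> because
  \<open>Y\<close> misses a vertex.\<close>

lemma inner_sparse:
  assumes "Y \<subset> V" "Y \<noteq> {}"
  shows "card (inner Y - {c}) < card Y"
proof (rule ccontr)
  assume less: "\<not> card (inner Y - {c}) < card Y"
  have finY: "finite Y" "0 < card Y" using assms finV by (auto simp: card_gt_0_iff intro: finite_subset)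
  have col: "colouring Y (inner Y - {c}) F" using assms by (intro colouring_inner) auto
  have "total (inner Y - {c}) F = 2 * card (inner Y - {c})"
    by (rule total_double) (auto simp: inner_def)
  then have "2 * card Y - 1 \<le> total (inner Y - {c}) F" "2 * card Y - 1 < 2 * card Y"
    using less finY by simp_all
  moreover have "disjoint_family_on F (inner Y - {c})" by (rule disjoint) (auto simp: inner_def)
  moreover have "card Y \<le> card (inner Y - {c})" using less by simp
  ultimately obtain vs where vs: "rainbow_circuit (inner Y - {c}) F vs"
    "2 * length vs + (2 * card Y - 1) \<le> 3 * card Y"
    using short_circuits_disjoint[OF smaller[OF assms(1)] col] by blast
  have "rainbow_circuit I F vs" using vs(1) by (rule rainbow_circuit_mono) (auto simp: inner_def)
  from circuit_long[OF this] vs(2) psubset_card_mono[OF finV assms(1)] card_V finY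
  show False by simp
qed

text \<open>The edge \<open>{x, y}\<close> in the free colour \<open>c\<close> closes such a path to
  a circuit on the same vertices.\<close>

lemma path_to_x_long:
  assumes "ps \<noteq> []" "hd ps = y" "last ps = x" "distinct ps" "rainbow J F (path_edges ps)"
    and "J \<subseteq> I - {c}"
  shows "h < length ps"
proof -
  have "2 \<le> length ps" using assms(1,2,3) c(3) by (cases ps rule: path_edges.cases) auto
  then have "rainbow_circuit I F ps"
    using assms c by (intro rainbow_circuit_close[of J F ps I c]) auto
  then show ?thesis by (rule circuit_long)
qed

text \<open>Restricting the path to colours that lie wholly inside \<open>Y\<close> ensures that any
  edge leaving \<open>Y\<close> has a fresh colour.\<close>

definition reach :: "'v set \<Rightarrow> nat \<Rightarrow> 'v \<Rightarrow> bool" where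
  "reach Y l u \<longleftrightarrow> (\<exists>ps. ps \<noteq> [] \<and> hd ps = y \<and> last ps = u \<and> distinct ps \<and> set ps \<subseteq> Y \<and>
     length ps \<le> l + 1 \<and> rainbow (inner Y) F (path_edges ps))"

lemma reach_mono:
  assumes "reach Y l u" "Y \<subseteq> Z" "l \<le> k"
  shows "reach Z k u"
proof -
  obtain ps where "ps \<noteq> []" "hd ps = y" "last ps = u" "distinct ps" "set ps \<subseteq> Y"
     "length ps \<le> l + 1" "rainbow (inner Y) F (path_edges ps)"
    using assms(1) by (auto simp: reach_def)
  then show ?thesis
    unfolding reach_def using assms(2,3) inner_mono[OF assms(2)]
    by (intro exI[of _ ps]) (auto intro: rainbow_mono)
qed

lemma extend_path:
  assumes "ps \<noteq> []" "distinct ps" "rainbow J F (path_edges ps)" "v \<notin> set ps"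
    and "i \<notin> J" "{last ps, v} \<in> F i"
  shows "distinct (ps @ [v])" "rainbow (insert i J) F (path_edges (ps @ [v]))"
  using assms rainbow_Cons[of J F "path_edges ps" i "{last ps, v}"]
  by (auto simp: path_edges_snoc rainbow_rotate1)

lemma reach_extend:
  assumes "reach Y l u" "v \<notin> Y" "i \<in> I" "{u, v} \<in> F i"
  obtains ps where "ps \<noteq> []" "hd ps = y" "last ps = v" "distinct ps" "set ps \<subseteq> insert v Y"
    "length ps \<le> l + 2" "rainbow (insert i (inner Y)) F (path_edges ps)"
proof -
  obtain ps where ps: "ps \<noteq> []" "hd ps = y" "last ps = u" "distinct ps" "set ps \<subseteq> Y"
     "length ps \<le> l + 1" "rainbow (inner Y) F (path_edges ps)"
    using assms(1) by (auto simp: reach_def)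
  have "i \<notin> inner Y" unfolding inner_def using assms(2,4) by blast
  moreover have "v \<notin> set ps" using assms(2) ps(5) by blast
  moreover note ps
  ultimately show thesis using assms extend_path[of ps "inner Y" v i]
    by (intro that[of "ps @ [v]"]) auto
qed

lemma inner_less: "x \<notin> Y \<Longrightarrow> inner Y \<subseteq> I - {c}"
  using c by (auto simp: inner_def)

lemma reach_neighbour_of_x:
  assumes "reach Y l u" "x \<notin> Y" "i \<in> I" "i \<noteq> c" "{u, x} \<in> F i"
  shows "h < l + 2"
proof -
  obtain ps where ps: "ps \<noteq> []" "hd ps = y" "last ps = x" "distinct ps" "set ps \<subseteq> insert x Y"
    "length ps \<le> l + 2" "rainbow (insert i (inner Y)) F (path_edges ps)"
    using reach_extend[OF assms(1,2,3,5)] .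
  have "insert i (inner Y) \<subseteq> I - {c}" using inner_less[OF assms(2)] assms(3,4) by auto
  from path_to_x_long[OF ps(1-4,7) this] ps(6) show ?thesis by simp
qed

text \<open>Balls around \<open>y\<close> from which no short path may leave towards \<open>x\<close>, as the single edge \<open>{x, y}\<close>
  would close it. The edge count \<open>card Y - 1\<close> keeps \<open>card_hit\<close> applicable to \<open>Y\<close>.\<close>

definition good :: "'v set \<Rightarrow> nat \<Rightarrow> bool" where
  "good Y l \<longleftrightarrow> Y \<subseteq> V \<and> y \<in> Y \<and> x \<notin> Y \<and> card Y \<le> cnt (\<lambda>f. f \<subseteq> Y) + 1 \<and> (\<forall>u\<in>Y. reach Y l u)"

text \<open>As \<open>Y\<close> contains \<open>y\<close> but not \<open>x\<close>, its degrees sum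
  to \<open>4 * card Y - 1\<close>. At least \<open>card Y - 1\<close> edges inside are counted
  twice there, so at most \<open>3 * card Y\<close> edges meet \<open>Y\<close> and
  \<open>card_hit\<close> applies. One hit colour is given up for \<open>c\<close>.\<close>

lemma good_hit:
  assumes "good Y l"
  shows "card Y \<le> card (hit Y - {c})"
proof -
  have Y: "Y \<subseteq> V" "y \<in> Y" "x \<notin> Y" "card Y \<le> cnt (\<lambda>f. f \<subseteq> Y) + 1"
    using assms by (auto simp: good_def)
  have finY: "finite Y" using Y(1) finV by (rule finite_subset)
  have "(\<Sum>v\<in>Y. deg v) + 1 = (\<Sum>v\<in>Y. deg v) + (\<Sum>v\<in>Y. if v = y then 1 else 0)"
    using Y(2) finY by simp
  also have "\<dots> = (\<Sum>v\<in>Y. deg v + (if v = y then 1 else 0))"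
    by (simp only: sum.distrib)
  also have "\<dots> = (\<Sum>v\<in>Y. 4)"
  proof (rule sum.cong)
    fix v assume "v \<in> Y"
    then show "deg v + (if v = y then 1 else 0) = 4"
      using deg_eq[of v] Y by (auto split: if_splits)
  qed simp
  finally have "(\<Sum>v\<in>Y. deg v) + 1 = 4 * card Y" by simp
  then have "cnt (\<lambda>f. f \<inter> Y \<noteq> {}) \<le> 3 * card Y" using sum_deg[OF Y(1)] Y(4) by simp
  moreover have "Y \<subset> V" "Y \<noteq> {}" using Y vertices by auto
  ultimately have "card Y < card (hit Y)" by (intro card_hit)
  moreover have "card (hit Y) \<le> card (hit Y - {c}) + 1"
    by (cases "c \<in> hit Y") (auto simp: card_Diff_singleton)
  ultimately show ?thesis by simp
qed

text \<open>Adding to \<open>Y\<close> all edges of the hit colours other than \<open>c\<close> puts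
  at least \<open>card Y\<close> double colours inside \<open>Z\<close>, so by
  \<open>inner_sparse\<close> the set grows. Every new vertex is adjacent to \<open>Y\<close>, hence
  the radius grows by one only; \<open>x\<close> cannot be new, as \<open>{x, y}\<close> would close
  a path with at most \<open>l + 2\<close> vertices.\<close>

lemma good_step:
  assumes Y: "good Y l" and l: "l + 2 \<le> h"
  obtains Z where "good Z (l + 1)" "card Y < card Z" "card Y \<le> card (inner Z - {c})"
proof -
  have YV: "Y \<subseteq> V" "y \<in> Y" "x \<notin> Y" "card Y \<le> cnt (\<lambda>f. f \<subseteq> Y) + 1"
    and reach: "\<And>u. u \<in> Y \<Longrightarrow> reach Y l u"
    using Y by (auto simp: good_def)
  define T where "T = hit Y - {c}"
  define Z where "Z = Y \<union> (\<Union>i\<in>T. \<Union>(F i))"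
  have TI: "T \<subseteq> I" "c \<notin> T" by (auto simp: T_def hit_def)
  have YZ: "Y \<subseteq> Z" by (auto simp: Z_def)
  have ZV: "Z \<subseteq> V" using YV(1) TI edge_subset by (fastforce simp: Z_def)
  have finZ: "finite Z" using ZV finV by (rule finite_subset)
  have new: "\<exists>i u. i \<in> T \<and> u \<in> Y \<and> {u, v} \<in> F i" if v: "v \<in> Z - Y" for v
  proof -
    obtain i f where i: "i \<in> T" "f \<in> F i" "v \<in> f" using v by (auto simp: Z_def)
    then obtain u where u: "u \<in> f" "u \<in> Y" by (auto simp: T_def hit_def)
    have "card f = 2" using edge_card i TI by auto
    then have "f = {u, v}" using u v i(3) by (auto simp: card_2_iff)
    with i u show ?thesis by auto
  qed
  have xZ: "x \<notin> Z"
  proof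
    assume "x \<in> Z"
    with new[of x] YV obtain i u where "i \<in> T" "u \<in> Y" "{u, x} \<in> F i" by auto
    with reach_neighbour_of_x[OF reach YV(3)] TI l show False by fastforce
  qed
  have TZ: "T \<subseteq> inner Z - {c}" using TI by (auto simp: inner_def Z_def)
  have "finite (inner Z - {c})" using finI by (auto simp: inner_def)
  then have inn: "card Y \<le> card (inner Z - {c})"
    using card_mono[OF _ TZ] good_hit[OF Y] by (simp add: T_def)
  have "Z \<subset> V" "Z \<noteq> {}" using ZV xZ vertices YZ YV by auto
  from inner_sparse[OF this] inn have less: "card Y < card Z" by simp
  obtain a b where ab: "\<And>v. v \<in> Z - Y \<Longrightarrow> a v \<in> T \<and> b v \<in> Y \<and> {b v, v} \<in> F (a v)"
    using new by metis
  have "good Z (l + 1)"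
    unfolding good_def
  proof (intro conjI ballI ZV xZ)
    show "y \<in> Z" using YV YZ by auto
    \<comment> \<open>One edge into \<open>Y\<close> for each new vertex; these are distinct and not
      inside \<open>Y\<close>, so the inner edges keep pace with the vertices.\<close>
    let ?g = "\<lambda>v. {b v, v}"
    have "inj_on ?g (Z - Y)"
      using ab by (intro inj_onI) (auto simp: doubleton_eq_iff)
    then have "card (Z - Y) = card (?g ` (Z - Y))" by (simp add: card_image)
    moreover have "card ({f \<in> edges. f \<subseteq> Y} \<union> ?g ` (Z - Y)) =
        card {f \<in> edges. f \<subseteq> Y} + card (?g ` (Z - Y))"
      using finite_edges finZ by (intro card_Un_disjoint) auto
    moreover have "{f \<in> edges. f \<subseteq> Y} \<union> ?g ` (Z - Y) \<subseteq> {f \<in> edges. f \<subseteq> Z}"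
    proof -
      have "{b v, v} \<in> edges \<and> {b v, v} \<subseteq> Z" if "v \<in> Z - Y" for v
        using ab[OF that] that TI YZ edgesI by blast
      then show ?thesis using YZ by auto
    qed
    then have "card ({f \<in> edges. f \<subseteq> Y} \<union> ?g ` (Z - Y)) \<le> cnt (\<lambda>f. f \<subseteq> Z)"
      unfolding cnt_def using finite_edges by (intro card_mono) auto
    ultimately have "cnt (\<lambda>f. f \<subseteq> Y) + card (Z - Y) \<le> cnt (\<lambda>f. f \<subseteq> Z)" by (simp add: cnt_def)
    moreover have "card (Z - Y) + card Y = card Z"
      using YZ finZ by (simp add: card_Diff_subset card_mono finite_subset)
    ultimately show "card Z \<le> cnt (\<lambda>f. f \<subseteq> Z) + 1" using YV(4) by simp
    fix v assume "v \<in> Z"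
    show "reach Z (l + 1) v"
    proof (cases "v \<in> Y")
      case True
      then show ?thesis using reach_mono[OF reach YZ, of v "l + 1"] by simp
    next
      case False
      with \<open>v \<in> Z\<close> new obtain i u where iu: "i \<in> T" "u \<in> Y" "{u, v} \<in> F i" by blast
      then have "i \<in> I" using TI by auto
      obtain ps where ps: "ps \<noteq> []" "hd ps = y" "last ps = v" "distinct ps" "set ps \<subseteq> insert v Y"
        "length ps \<le> l + 2" "rainbow (insert i (inner Y)) F (path_edges ps)"
        using reach_extend[OF reach[OF iu(2)] False \<open>i \<in> I\<close> iu(3)] .
      have "insert i (inner Y) \<subseteq> inner Z" using inner_mono[OF YZ] TZ iu(1) by auto
      with ps(7) have "rainbow (inner Z) F (path_edges ps)" by (rule rainbow_mono) auto
      with ps \<open>v \<in> Z\<close> YZ show ?thesis unfolding reach_def by (intro exI[of _ ps]) auto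
    qed
  qed
  with less inn that show thesis by blast
qed

text \<open>A set with as many inner colours as possible has a smaller radius: adding any edge at
  \<open>y\<close> as a further colour creates a short circuit through that edge.\<close>

lemma good_dense:
  assumes Y: "good Y (l + 1)" and card_Y: "card Y = 2 * l + 2" "card Y \<le> card (inner Y - {c}) + 1"
    and l: "l + 1 \<le> h"
  shows "good Y l"
proof -
  have YV: "Y \<subseteq> V" "y \<in> Y" "x \<notin> Y" "card Y \<le> cnt (\<lambda>f. f \<subseteq> Y) + 1"
    using Y by (auto simp: good_def)
  have finY: "finite Y" using YV(1) finV by (rule finite_subset)
  have psub: "Y \<subset> V" using YV vertices by auto
  obtain T where T: "T \<subseteq> inner Y - {c}" "card T = 2 * l + 1" "finite T"
    using obtain_subset_with_card_n[of "2 * l + 1" "inner Y - {c}"] card_Y by auto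
  have TI: "T \<subseteq> I - {c}" using T by (auto simp: inner_def)
  have "reach Y l u" if u: "u \<in> Y" for u
  proof (cases "u = y")
    case True
    with YV show ?thesis unfolding reach_def by (intro exI[of _ "[y]"]) auto
  next
    case False
    \<comment> \<open>The edge of \<open>c\<close> leaves \<open>Y\<close>, so the colour
      \<open>c\<close> is free to carry the artificial edge \<open>{y, u}\<close>.\<close>
    define G where "G = F(c := {{y, u}})"
    have colT: "colouring Y T F" using YV(1) T(1) by (intro colouring_inner) auto
    have G: "colouring Y (insert c T) G"
      using colT YV(2) u False unfolding colouring_def G_def
      by (auto simp: nsets_def)
    have "total T G = total T F" using TI by (intro sum.cong) (auto simp: G_def)
    then have tot: "total (insert c T) G = 4 * l + 3"
      using TI T total_double[OF TI] by (subst sum.insert) (auto simp: G_def)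
    moreover have "card (insert c T) = card Y" using TI T card_Y by (subst card_insert_disjoint) auto
    \<comment> \<open>The total \<open>4 * l + 3\<close> is \<open>2 * card Y - 1\<close>, which
      bounds the circuit by \<open>l + 1\<close> vertices. If it avoids \<open>c\<close> it is a
      short circuit of \<open>F\<close>; otherwise, opened at \<open>{y, u}\<close>, it is a path of
      length at most \<open>l\<close>.\<close>
    ultimately obtain vs where vs: "rainbow_circuit (insert c T) G vs" "2 * length vs + (4 * l + 3) \<le> 3 * card Y"
      using short_circuitsD[OF smaller[OF psub] G, of "4 * l + 3"] card_Y by auto
    then have len: "length vs \<le> l + 1" using card_Y by simp
    have vsY: "set vs \<subseteq> Y" using colouring_circuit_subset[OF G vs(1)] .
    have "2 \<le> length vs" using vs(1) by (simp add: rainbow_circuit_def)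
    from vs(1) show ?thesis
    proof (cases rule: rainbow_circuit_open)
      case 1
      then have "rainbow_circuit I F vs"
        by (rule rainbow_circuit_mono) (use TI in \<open>auto simp: G_def\<close>)
      from circuit_long[OF this] len l show ?thesis by simp
    next
      case (2 ps)
      from 2(5) have path: "rainbow (inner Y) F (path_edges ps)"
        by (rule rainbow_mono) (use T in \<open>auto simp: G_def\<close>)
      have ne: "ps \<noteq> []" using 2(1) \<open>2 \<le> length vs\<close> by auto
      have "{last ps, hd ps} = {y, u}" using 2(4) by (simp add: G_def)
      then consider "hd ps = y" "last ps = u" | "last ps = y" "hd ps = u"
        by (auto simp: doubleton_eq_iff)
      then show ?thesis
      proof cases
        case 1
        then show ?thesis
          unfolding reach_def using 2 ne path len vsY by (intro exI[of _ ps]) auto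
      next
        case b: 2
        then show ?thesis
          unfolding reach_def using 2 ne path len vsY
          by (intro exI[of _ "rev ps"]) (auto simp: path_edges_rev hd_rev last_rev)
      qed
    qed
  qed
  with YV show ?thesis by (auto simp: good_def)
qed

text \<open>A step guarantees only one new vertex where two are required. If \<open>Z\<close> has
  just \<open>2 * l + 2\<close> vertices, it has at least \<open>2 * l + 1\<close> inner colours
  besides \<open>c\<close>, so \<open>good_dense\<close> lowers its radius back to \<open>l\<close>
  and a second step supplies the missing vertex.\<close>

lemma good_exists: "l + 3 \<le> h \<Longrightarrow> \<exists>Y. good Y l \<and> 2 * l + 1 \<le> card Y"
proof (induction l)
  case 0
  have "good {y} 0"
    unfolding good_def reach_def using vertices c by (auto intro!: exI[of _ "[y]"])
  then show ?case by (intro exI[of _ "{y}"]) auto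
next
  case (Suc l)
  then obtain Y where Y: "good Y l" "2 * l + 1 \<le> card Y" by auto
  have l: "l + 2 \<le> h" using Suc by simp
  obtain Z where Z: "good Z (l + 1)" "card Y < card Z" "card Y \<le> card (inner Z - {c})"
    using good_step[OF Y(1) l] .
  show ?case
  proof (cases "2 * l + 3 \<le> card Z")
    case True
    with Z show ?thesis by (intro exI[of _ Z]) auto
  next
    case False
    with Y(2) Z have card_Z: "card Z = 2 * l + 2" "card Z \<le> card (inner Z - {c}) + 1" by auto
    then have good: "good Z l" using l by (intro good_dense[OF Z(1)]) auto
    obtain W where "good W (l + 1)" "card Z < card W" using good_step[OF good l] .
    with card_Z(1) show ?thesis by (intro exI[of _ W]) auto
  qed
qed


section \<open>The neighbourhoods of \<open>p\<close> and \<open>q\<close>\<close>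

lemma third_star:
  assumes "{x, z} \<in> F d"
  shows "\<exists>j\<in>I - {c, d}. \<forall>f\<in>F j. z \<in> f"
proof -
  have z: "z \<noteq> x" "z \<noteq> y" "z \<in> V" "{x, z} \<in> edges"
    using assms d distinct_vertices vertices edgesI[OF d(1)] by (auto simp: doubleton_eq_iff)
  have "card {f \<in> edges. f \<subseteq> {x, z}} \<noteq> 0" using z finite_edges by auto
  then have "1 \<le> cnt (\<lambda>f. f \<subseteq> {x, z})" unfolding cnt_def by linarith
  \<comment> \<open>The edge \<open>{x, z}\<close> is counted twice in this sum, so at most 6 edges
    meet the pair. Deleting it therefore destroys at least three colours, one of them neither
    \<open>c\<close> nor \<open>d\<close>; that one does not meet \<open>x\<close>, so all its edges
    contain \<open>z\<close>.\<close>
  moreover have "deg x + deg z = 7" using deg_eq[of x] deg_eq[of z] z vertices by simp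
  ultimately have "cnt (\<lambda>f. f \<inter> {x, z} \<noteq> {}) \<le> 3 * card {x, z}"
    using sum_deg[of "{x, z}"] z vertices by simp
  moreover have "{x, z} \<subset> V" using z vertices c(3) by auto
  ultimately have "card {x, z} < card (hit {x, z})" by (intro card_hit) auto
  then have "card {c, d} < card (hit {x, z})" using z d(2) by simp
  moreover have "finite (hit {x, z})" using finI by (simp add: hit_def)
  ultimately have "\<not> hit {x, z} \<subseteq> {c, d}" using card_mono[of "{c, d}" "hit {x, z}"] by auto
  then obtain j where j: "j \<in> I - {c, d}" "\<forall>f\<in>F j. f \<inter> {x, z} \<noteq> {}" by (auto simp: hit_def)
  then have "\<forall>f\<in>F j. z \<in> f" using colours_at_x by blast
  with j(1) show ?thesis by blast
qed

text \<open>A path inside \<open>Y\<close> to a neighbour \<open>w\<close> of \<open>z\<close>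
  extends through \<open>z\<close> to \<open>x\<close>, using two fresh colours. It has at most
  \<open>l + 3\<close> vertices, too few for a path from \<open>y\<close> to \<open>x\<close>. If
  \<open>z\<close> itself were in \<open>Y\<close>, the path would be shorter still.\<close>

lemma neighbours_outside:
  assumes Y: "good Y l" "l + 3 \<le> h" and z: "{x, z} \<in> F d"
  shows "z \<notin> Y" "{z, w} \<in> edges \<Longrightarrow> w \<notin> Y"
proof -
  have xY: "x \<notin> Y" and reach: "\<And>u. u \<in> Y \<Longrightarrow> reach Y l u" using Y by (auto simp: good_def)
  have zxy: "z \<noteq> x" "z \<noteq> y"
    using z d distinct_vertices by (auto simp: doubleton_eq_iff)
  show zY: "z \<notin> Y"
    using reach_neighbour_of_x[OF reach xY d(1,2)] z Y(2) by (fastforce simp: insert_commute)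
  assume "{z, w} \<in> edges"
  then obtain i where i: "i \<in> I" "{w, z} \<in> F i" by (auto simp: insert_commute elim: edgesE)
  show "w \<notin> Y"
  proof
    assume w: "w \<in> Y"
    have "{w, z} \<noteq> {x, y}" using zxy by (auto simp: doubleton_eq_iff)
    then have ic: "i \<noteq> c" using i c by auto
    have "x \<notin> {w, z}" using w xY zxy by auto
    then have id: "i \<noteq> d" using i d by auto
    obtain ps where ps: "ps \<noteq> []" "hd ps = y" "last ps = z" "distinct ps" "set ps \<subseteq> insert z Y"
      "length ps \<le> l + 2" "rainbow (insert i (inner Y)) F (path_edges ps)"
      using reach_extend[OF reach[OF w] zY i] .
    have "d \<notin> insert i (inner Y)" using xY d id by (auto simp: inner_def)
    moreover have "x \<notin> set ps" using ps(5) xY zxy by auto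
    ultimately have ext: "distinct (ps @ [x])"
      "rainbow (insert d (insert i (inner Y))) F (path_edges (ps @ [x]))"
      using extend_path[OF ps(1,4,7), of x d] ps(3) z by (auto simp: insert_commute)
    have "insert d (insert i (inner Y)) \<subseteq> I - {c}" using inner_less[OF xY] i d ic by auto
    from path_to_x_long[OF _ _ _ ext this] ps(1,2,6) Y(2) show False by simp
  qed
qed

lemma no_rainbow_triangle:
  assumes "{u, v} \<in> F i" "{v, w} \<in> F j" "{w, u} \<in> F k"
    and "distinct [i, j, k]" "{i, j, k} \<subseteq> I" "distinct [u, v, w]"
  shows False
proof -
  have "rainbow I F [{u, v}, {v, w}, {w, u}]"
    unfolding rainbow_iff using assms by (intro exI[of _ "[i, j, k]"]) auto
  then have "rainbow_circuit I F [u, v, w]"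
    using assms(6) by (simp add: rainbow_circuit_def)
  from circuit_long[OF this] h_ge3 show False by simp
qed

text \<open>Away from \<open>x\<close> and \<open>y\<close> every degree is exactly 4, so at most
  four candidate neighbours must all occur.\<close>

lemma full_neighbourhood:
  assumes "z \<in> V" "z \<noteq> x" "z \<noteq> y" "finite N" "card N \<le> 4"
    and "\<And>w. {z, w} \<in> edges \<Longrightarrow> w \<in> N"
  shows "card N = 4" "w \<in> N \<Longrightarrow> {z, w} \<in> edges"
proof -
  let ?E = "{f \<in> edges. z \<in> f}"
  have card_E: "card ?E = 4" using deg_eq[OF assms(1)] assms(2,3) by (simp add: deg_def cnt_def)
  have sub: "?E \<subseteq> (\<lambda>w. {z, w}) ` N"
  proof
    fix f assume f: "f \<in> ?E"
    then have "card f = 2" using edges_card by auto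
    with f obtain w where "f = {z, w}" by (auto simp: card_2_iff)
    with f assms(6) show "f \<in> (\<lambda>w. {z, w}) ` N" by auto
  qed
  have le: "card ((\<lambda>w. {z, w}) ` N) \<le> card N" using assms(4) by (rule card_image_le)
  have "4 \<le> card ((\<lambda>w. {z, w}) ` N)"
    using card_mono[OF _ sub] assms(4) card_E by simp
  with le assms(5) show "card N = 4" by simp
  have "?E = (\<lambda>w. {z, w}) ` N"
    using card_seteq[OF _ sub] le assms(4,5) card_E by simp
  then show "{z, w} \<in> edges" if "w \<in> N" using that by blast
qed

text \<open>A ball of radius \<open>h - 3\<close> leaves at most five vertices outside. Then \<open>p\<close> and \<open>q\<close> are adjacent
  and have two common neighbours \<open>r\<close>, \<open>s\<close>, and the stars at \<open>p\<close> and \<open>q\<close> yield a rainbow triangle.\<close>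

lemma contradiction: False
proof -
  obtain l where l: "h = l + 3" using h_ge3 le_Suc_ex by (metis add.commute)
  obtain Y where Y: "good Y l" "2 * l + 1 \<le> card Y" using good_exists[of l] l by auto
  have YV: "Y \<subseteq> V" "x \<notin> Y" using Y(1) by (auto simp: good_def)
  have xp: "{x, p} \<in> F d" and xq: "{x, q} \<in> F d" using d by auto
  have l3: "l + 3 \<le> h" using l by simp
  note p_out = neighbours_outside[OF Y(1) l3 xp] and q_out = neighbours_outside[OF Y(1) l3 xq]
  define D where "D = V - Y - {x, p, q}"
  have finD: "finite D" using finV by (simp add: D_def)
  have "card (V - Y) = card V - card Y"
    using YV finV by (intro card_Diff_subset) (auto intro: finite_subset)
  \<comment> \<open>With \<open>h = l + 3\<close>, the difference \<open>2 * h - (2 * l + 1)\<close>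
    is 5.\<close>
  then have "card (V - Y) \<le> 5" using Y(2) card_V l by simp
  moreover have "card D = card (V - Y) - card {x, p, q}"
    unfolding D_def using YV p_out(1) q_out(1) vertices by (intro card_Diff_subset) auto
  moreover have "card {x, p, q} = 3" using distinct_vertices d(4) by auto
  ultimately have card_D: "card D \<le> 2" by simp
  have loopless: "{z, z} \<notin> edges" for z using edges_card[of "{z, z}"] by auto
  have N: "card (insert x (insert z D)) \<le> 4" for z
    using card_D card_insert_le_m1[of 4 "insert z D" x] card_insert_le_m1[of 3 D z] by simp
  have nb_p: "w \<in> insert x (insert q D)" if "{p, w} \<in> edges" for w
    using p_out(2)[OF that] edges_subset[OF that] loopless[of p] that by (auto simp: D_def)
  have nb_q: "w \<in> insert x (insert p D)" if "{q, w} \<in> edges" for w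
    using q_out(2)[OF that] edges_subset[OF that] loopless[of q] that by (auto simp: D_def)
  note full_p = full_neighbourhood[OF vertices(3) distinct_vertices(1,3) _ N nb_p, simplified]
  note full_q = full_neighbourhood[OF vertices(4) distinct_vertices(2,4) _ N nb_q, simplified]
  have "x \<notin> insert q D" "q \<notin> D" using distinct_vertices by (auto simp: D_def)
  then have "card D = 2" using full_p(1) finD by simp
  then obtain r s where D: "D = {r, s}" "r \<noteq> s" by (auto simp: card_2_iff)
  have rs: "r \<notin> {x, p, q}" "s \<notin> {x, p, q}" using D unfolding D_def by blast+
  have present: "{p, q} \<in> edges" "\<And>b. b \<in> {r, s} \<Longrightarrow> {p, b} \<in> edges"
    "\<And>b. b \<in> {r, s} \<Longrightarrow> {q, b} \<in> edges"
    using full_p(2) full_q(2) finD D by auto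
  obtain i where i: "i \<in> I" "i \<noteq> c" "i \<noteq> d" "\<forall>f\<in>F i. p \<in> f" using third_star[OF xp] by auto
  obtain j where j: "j \<in> I" "j \<noteq> c" "j \<noteq> d" "\<forall>f\<in>F j. q \<in> f" using third_star[OF xq] by auto
  have star: "\<exists>w. f = {z, w}" if "k \<in> I" "f \<in> F k" "z \<in> f" for k f z
    using edge_card[OF that(1,2)] that(3) by (auto simp: card_2_iff)
  have Fi: "F i \<subseteq> {{p, q}, {p, r}, {p, s}}"
  proof
    fix f assume f: "f \<in> F i"
    then obtain w where w: "f = {p, w}" using star[OF i(1) f] i(4) by auto
    have "x \<notin> f" using colours_at_x[OF i(1) f] i by auto
    moreover have "w \<in> insert x (insert q D)" using nb_p edgesI[OF i(1) f] w by simp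
    ultimately show "f \<in> {{p, q}, {p, r}, {p, s}}" using w D by auto
  qed
  have Fj: "F j \<subseteq> {{q, p}, {q, r}, {q, s}}"
  proof
    fix f assume f: "f \<in> F j"
    then obtain w where w: "f = {q, w}" using star[OF j(1) f] j(4) by auto
    have "x \<notin> f" using colours_at_x[OF j(1) f] j by auto
    moreover have "w \<in> insert x (insert p D)" using nb_q edgesI[OF j(1) f] w by simp
    ultimately show "f \<in> {{q, p}, {q, r}, {q, s}}" using w D by auto
  qed
  have both: "{v, r} \<in> F k" "{v, s} \<in> F k"
    if k: "k \<in> I" "k \<noteq> c" "F k \<subseteq> {{v, u}, {v, r}, {v, s}}" "{v, u} \<notin> F k" for k u v
  proof -
    have sub: "F k \<subseteq> {{v, r}, {v, s}}" using k(3,4) by auto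
    have "card {{v, r}, {v, s}} \<le> card (F k)"
      using double[OF k(1,2)] by (simp add: card_insert_if)
    with card_seteq[OF _ sub] have "F k = {{v, r}, {v, s}}" by simp
    then show "{v, r} \<in> F k" "{v, s} \<in> F k" by auto
  qed
  have ij: "i \<noteq> j"
  proof
    assume "i = j"
    then have "F i \<subseteq> {{p, q}}" using Fi j(4) rs d(4) by (auto simp: insert_commute)
    then have "card (F i) \<le> card {{p, q}}" by (intro card_mono) auto
    with double[OF i(1,2)] show False by simp
  qed
  \<comment> \<open>Stated for \<open>u\<close>, \<open>v\<close> to serve \<open>p\<close> and
    \<open>q\<close> in both orders. The star at \<open>u\<close> contains \<open>{u, v}\<close> and
    so misses \<open>{u, b}\<close> for some \<open>b\<close> in \<open>{r, s}\<close>, while the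
    star at \<open>v\<close> must consist of \<open>{v, r}\<close> and \<open>{v, s}\<close>. In the
    triangle \<open>u\<close>, \<open>v\<close>, \<open>b\<close> the edge \<open>{u, b}\<close>
    then has a third colour.\<close>
  have tri: False
    if k: "k \<in> I" "k \<noteq> c" "F k \<subseteq> {{u, v}, {u, r}, {u, s}}" "{u, v} \<in> F k"
      and m: "m \<in> I" "m \<noteq> c" "F m \<subseteq> {{v, u}, {v, r}, {v, s}}"
      and uv: "k \<noteq> m" "u \<noteq> v" "u \<notin> {r, s}" "v \<notin> {r, s}" "{u, r} \<in> edges" "{u, s} \<in> edges"
    for k m u v
  proof -
    have "{v, u} \<notin> F m" using colour_unique[of k m "{u, v}"] k m uv by (auto simp: insert_commute)
    with both[OF m] have m2: "{v, r} \<in> F m" "{v, s} \<in> F m" by auto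
    have "\<not> {{u, v}, {u, r}, {u, s}} \<subseteq> F k"
    proof
      assume "{{u, v}, {u, r}, {u, s}} \<subseteq> F k"
      then have "card {{u, v}, {u, r}, {u, s}} \<le> 2"
        using card_mono[OF finF[OF k(1)]] double[OF k(1,2)] by metis
      moreover have "card {{u, v}, {u, r}, {u, s}} = 3"
        using uv D by (simp add: doubleton_eq_iff card_insert_if)
      ultimately show False by simp
    qed
    then obtain b where b: "b \<in> {r, s}" "{u, b} \<notin> F k" using k(4) by auto
    have "{u, b} \<in> edges" "{v, b} \<in> F m" using b uv m2 by auto
    then obtain o' where o: "o' \<in> I" "{u, b} \<in> F o'" by (auto elim: edgesE)
    have "{u, b} \<notin> F m" using m(3) uv b by (auto simp: doubleton_eq_iff)
    with o b have "distinct [k, m, o']" using uv(1) by auto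
    moreover have "distinct [u, v, b]" using b uv by auto
    ultimately show False
      using no_rainbow_triangle[of u v k b m o'] k m o \<open>{v, b} \<in> F m\<close> by (simp add: insert_commute)
  qed
  consider "{p, q} \<in> F i" | "{q, p} \<in> F j" | "{p, q} \<notin> F i" "{q, p} \<notin> F j" by blast
  then show False
  proof cases
    case 1
    show False
      by (rule tri[OF i(1,2) Fi 1 j(1,2) Fj ij d(4)]) (use rs present in auto)
  next
    case 2
    show False
      by (rule tri[OF j(1,2) Fj 2 i(1,2) Fi ij[symmetric] d(4)[symmetric]]) (use rs present in auto)
  next
    case 3
    \<comment> \<open>Both stars consist of the edges to \<open>r\<close> and \<open>s\<close>, so
      here it is \<open>{p, q}\<close> that has the third colour.\<close>
    obtain k where k: "k \<in> I" "{p, q} \<in> F k" using present(1) by (rule edgesE)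
    have "{p, r} \<in> F i" "{q, r} \<in> F j" using both[OF i(1,2) Fi 3(1)] both[OF j(1,2) Fj 3(2)] by auto
    moreover have "distinct [k, j, i]" using 3 k ij by (auto simp: insert_commute)
    moreover have "distinct [p, q, r]" using d(4) rs by auto
    ultimately show False
      using no_rainbow_triangle[of p q k r j i] k i(1) j(1) by (simp add: insert_commute)
  qed
qed

end

section \<open>Reduction to the critical case, induction and the theorem\<close>

lemma (in minimal_counterexample) impossible: False
proof -
  obtain c where "c \<in> I" "card (F c) = 1" using single_colour by auto
  then obtain e where e: "c \<in> I" "F c = {e}" by (auto simp: card_1_singleton_iff)
  then obtain x y where xy: "e = {x, y}" "x \<noteq> y" using edge_card[of c e] by (auto simp: card_2_iff)
  note c = e(1) e(2)[unfolded xy(1)] xy(2)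
  have x: "x \<in> V" using edge_subset[of c e] e xy by auto
  have deg_x: "deg x \<le> 3" by (rule deg_single_end[OF c(1,2)]) simp
  have "card (stars x) = 2" by (rule card_stars_eq_2[OF x deg_x])
  moreover have "c \<in> stars x" using c by (auto simp: stars_def)
  ultimately obtain d where d: "d \<in> stars x" "d \<noteq> c"
    by (metis card_2_iff insertCI)
  then have dI: "d \<in> I" by (simp add: stars_def)
  obtain f g where fg: "F d = {f, g}" "f \<noteq> g"
    using double_if_not_single[OF c dI d(2)] by (auto simp: card_2_iff)
  have "x \<in> f" "x \<in> g" "card f = 2" "card g = 2" using fg d dI edge_card by (auto simp: stars_def)
  then obtain p q where pq: "f = {x, p}" "g = {x, q}" by (auto simp: card_2_iff)
  obtain h where h: "card V = 2 * h" using contraction_bound(2)[OF c] by (auto elim: evenE)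
  interpret critical_counterexample V I F c d x y p q h
    by unfold_locales (use c d dI fg pq h in auto)
  show False by (rule contradiction)
qed

lemma short_circuits_finite:
  assumes "finite (V :: 'v set)"
  shows "short_circuits TYPE('i) V"
  using assms
proof (induction V rule: finite_psubset_induct)
  case (psubset V)
  show ?case
    unfolding short_circuits_def
  proof (intro allI impI, rule ccontr)
    fix I and F :: "'i \<Rightarrow> 'v set set"
    assume "colouring V I F" "card I = card V" "total I F < 2 * card V"
      and none: "\<nexists>vs. rainbow_circuit I F vs \<and> 2 * length vs + total I F \<le> 3 * card V"
    then interpret minimal_counterexample V I F
      by unfold_locales (use psubset.IH in \<open>auto simp: not_le\<close>)
    show False by (rule impossible)
  qed
qed

theorem theorem3p1:
  fixes V :: "'v set" and E :: "'v set set" and F :: "nat \<Rightarrow> 'v set set" and n p :: nat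
  assumes "simple_graph V E" and "card V = n" and "n \<ge> 1"
    and "\<And>i. i \<in> {1..n} \<Longrightarrow> F i \<subseteq> E"
    and "\<And>i. i \<in> {1..n} \<Longrightarrow> 1 \<le> card (F i) \<and> card (F i) \<le> 2"
    and "p = card {i \<in> {1..n}. card (F i) = 1}"
  shows "\<exists>vs. rainbow_cycle E {1..n} F vs \<and> int (length vs) \<le> \<lceil>(real n + real p) / 2\<rceil>"
proof -
  let ?I = "{1..n}"
  have finV: "finite V" and E: "E \<subseteq> nsets V 2" using assms(1) by (auto simp: simple_graph_def)
  have col: "colouring V ?I F"
    unfolding colouring_def
  proof (intro conjI ballI)
    fix i assume i: "i \<in> ?I"
    show "F i \<subseteq> nsets V 2" using assms(4)[OF i] E by blast
    show "1 \<le> card (F i)" "card (F i) \<le> 2" using assms(5)[OF i] by auto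
  qed (use finV in auto)
  have "total ?I F + p = (\<Sum>i\<in>?I. card (F i) + (if card (F i) = 1 then 1 else 0))"
    unfolding assms(6) by (simp add: sum.distrib sum.If_cases Int_def)
  also have "\<dots> = (\<Sum>i\<in>?I. 2)"
  proof (rule sum.cong)
    fix i assume i: "i \<in> ?I"
    show "card (F i) + (if card (F i) = 1 then 1 else 0) = 2" using assms(5)[OF i] by auto
  qed simp
  finally have tot: "total ?I F + p = 2 * n" by simp
  \<comment> \<open>For \<open>p = 0\<close> the total is \<open>2 * n\<close>, one above the
    admissible range. Lowering it by one yields \<open>2 * length vs \<le> n + 1\<close>, which the
    ceiling of \<open>n / 2\<close> absorbs.\<close>
  define m where "m = (if p = 0 then 2 * n - 1 else 2 * n - p)"
  have "m \<le> total ?I F" "m < 2 * card V" using tot assms(2,3) by (auto simp: m_def)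
  then obtain vs where vs: "rainbow_circuit ?I F vs" "2 * length vs + m \<le> 3 * card V"
    using short_circuitsD[OF short_circuits_finite[OF finV] col] assms(2) by auto
  have ne: "vs \<noteq> []" using vs(1) by (auto simp: rainbow_circuit_def)
  have rb: "rainbow ?I F (cycle_edges vs)"
    using vs(1) by (simp add: rainbow_circuit_def cycle_edges_eq[OF ne])
  have "set (cycle_edges vs) \<subseteq> E"
    using rainbow_edge[OF rb] assms(4) by blast
  then have "rainbow_cycle E ?I F vs"
    using vs(1) rb by (simp add: rainbow_cycle_def cycle_def rainbow_circuit_def)
  moreover have "2 * length vs \<le> n + max p 1"
    using vs(2) tot assms(2,3) by (auto simp: m_def split: if_splits)
  then have "int (length vs) \<le> \<lceil>(real n + real p) / 2\<rceil>"
    by (auto simp: le_ceiling_iff max_def split: if_splits)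
  ultimately show ?thesis by blast
qed

end
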